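(* Let $(\mathcal X,\mathfrak S)$ be a hierarchically hyperbolic space. For each sufficiently large $\theta$ there exist $K,C\ge1$ so that for each nonempty set $A\subset\mathcal X$ there is a $(K,K)$-coarsely Lipschitz map $r_A:\mathcal X\to H_\theta(A)$ restricting to the identity on $H_\theta(A)$. Moreover, if $A'\subset\mathcal X$ lies at finite Hausdorff distance from $A$, then $d_{\mathcal X}(r_A(x),r_{A'}(x))$ is $C$-coarsely Lipschitz in $d_{Haus,\mathcal X}(A,A')$, i.e. $d_{\mathcal X}(r_A(x),r_{A'}(x))\le C\,d_{Haus,\mathcal X}(A,A')+C$ for all $x\in\mathcal X$.
   Context: Hulls. For a subset $B$ of a $\delta$-hyperbolic space $H$, $\mathrm{hull}_H(B)$ is the union of all geodesics between pairs of points of $B$. For $A\subset\mathcal X$ and $\theta\ge0$, $H_\theta(A)$ is the set of all $p\in\mathcal X$ such that for each $W\in\mathfrak S$ the set $\pi_W(p)$ lies at distance at most $\theta$ from $\mathrm{hull}_{\mathcal CW}(\pi_W(A))$. $d_{Haus,\mathcal X}$ denotes Hausdorff distance in $\mathcal X$. Hierarchically hyperbolic spaces (HHS). A $q$-quasigeodesic space is a metric space in which any two points are joined by a $(q,q)$-quasigeodesic. A $q$-quasigeodesic space $(\mathcal X,d_{\mathcal X})$ is an HHS (with structure $\mathfrak S$; one writes $(\mathcal X,\mathfrak S)$) if there are $\delta\ge0$, an index set $\mathfrak S$ and $\delta$-hyperbolic geodesic spaces $(\mathcal CW,d_W)$, $W\in\mathfrak S$, such that (1)–(9) below hold. Conventions: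 the distance between two sets is the infimum of distances between their points; for $x,y\in\mathcal X$ and $p\subseteq\mathcal CW$, $d_W(x,y)=d_W(\pi_W(x),\pi_W(y))$ and $d_W(x,p)=d_W(\pi_W(x),p)$; $\pi_W(A)=\bigcup_{a\in A}\pi_W(a)$; $V\sqsubset W$ means $V\sqsubseteq W$ and $V\ne W$. (1) Projections: there are $\xi,K\ge 0$ and maps $\pi_W:\mathcal X\to2^{\mathcal CW}$ ($W\in\mathfrak S$) sending points to nonempty sets of diameter $\le\xi$; each $\pi_W$ is $(K,K)$-coarsely Lipschitz and $\pi_W(\mathcal X)$ is $K$-quasiconvex in $\mathcal CW$. (2) Nesting: $\mathfrak S$ has a partial order $\sqsubseteq$, and either $\mathfrak S=\emptyset$ or there is a unique $\sqsubseteq$-maximal element. Put $\mathfrak S_W=\{V:V\sqsubseteq W\}$. If $V\sqsubset W$ there is a specified subset $\rho^V_W\subset\mathcal CW$ of diameter $\le\xi$ and a map $\rho^W_V:\mathcal CW\to2^{\mathcal CV}$. (3) Orthogonality: $\mathfrak S$ has a symmetric anti-reflexive relation $\perp$. If $V\sqsubseteq W$ and $W\perp U$ then $V\perp U$. For each $T\in\mathfrak S$ and $U\in\mathfrak S_T$ with $\{V\in\mathfrak S_T:V\perp U\}\ne\emptyset$ there is $W\in\mathfrak S_T-\{T\}$ such that $V\sqsubseteq W$ whenever $V\perp U$ and $V\sqsubseteq T$. If $V\perp W$ then $V,W$ are not $\sqsubseteq$-comparable. (4) Transversality and consistency: if $V,W$ are not orthogonal and neither is nested in the other they are transverse, $V\pitchfork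 W$. There is $\kappa_0\ge0$ such that: if $V\pitchfork W$ there are sets $\rho^V_W\subseteq\mathcal CW$, $\rho^W_V\subseteq\mathcal CV$ of diameter $\le\xi$ with $\min\{d_W(\pi_W(x),\rho^V_W),d_V(\pi_V(x),\rho^W_V)\}\le\kappa_0$ for all $x\in\mathcal X$; if $V\sqsubset W$ then $\min\{d_W(\pi_W(x),\rho^V_W),\mathrm{diam}_{\mathcal CV}(\pi_V(x)\cup\rho^W_V(\pi_W(x)))\}\le\kappa_0$ for all $x$; and if $U\sqsubseteq V$ then $d_W(\rho^U_W,\rho^V_W)\le\kappa_0$ whenever $V\sqsubset W$, or $V\pitchfork W$ and $W\not\perp U$. (5) Finite complexity: there is $n\ge0$ (the complexity) such that any set of pairwise $\sqsubseteq$-comparable elements has at most $n$ elements. (6) Large links: there are $\lambda\ge1$, $E\ge\max\{\xi,\kappa_0\}$ such that for $W\in\mathfrak S$, $x,x'\in\mathcal X$ and $N=\lambda d_W(x,x')+\lambda$ there is a collection $\{T_i\}\subseteq\mathfrak S_W-\{W\}$ of at most $\lfloor N\rfloor$ elements such that every $T\in\mathfrak S_W-\{W\}$ either lies in some $\mathfrak S_{T_i}$ or satisfies $d_T(x,x')<E$; moreover $d_W(x,\rho^{T_i}_W)\le N$ for all $i$. (7) Bounded geodesic image: there is $E>0$ such that for all $V\sqsubset W$ and all geodesics $\gamma$ of $\mathcal CW$, either $\mathrm{diam}_{\mathcal CV}(\rho^W_V(\gamma))\le E$ or $\gamma$ meets the $E$-neighborhood of $\rho^V_W$. (8) Partial realization: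 there is $\alpha$ such that for every family $\{V_j\}$ of pairwise orthogonal elements and $p_j\in\pi_{V_j}(\mathcal X)$ there is $x\in\mathcal X$ with $d_{V_j}(x,p_j)\le\alpha$ for all $j$, and $d_V(x,\rho^{V_j}_V)\le\alpha$ whenever $V_j\sqsubset V$ or $V\pitchfork V_j$ for some $j$. (9) Uniqueness: for each $\kappa\ge0$ there is $\theta_u(\kappa)$ such that $d_{\mathcal X}(x,y)\ge\theta_u(\kappa)$ implies $d_V(x,y)\ge\kappa$ for some $V\in\mathfrak S$.
   Formalization: The maps ρ^W_V from CW to subsets of CV are required to take nonempty values; if empty values were allowed, consistency and bounded geodesic image could hold vacuously and the proposition would fail. *)

theory Defs
  imports "HOL-Analysis.Analysis"
begin

section \<open>Distances and diameters of sets\<close>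

text \<open>Values are taken in \<^typ>\<open>ennreal\<close>, so that the infimum over an empty set is \<open>\<infinity>\<close>, the
  supremum over an empty set is \<open>0\<close>, and an unbounded set has diameter \<open>\<infinity>\<close>.\<close>

definition set_dist :: "'a metric \<Rightarrow> 'a set \<Rightarrow> 'a set \<Rightarrow> ennreal" where
  "set_dist m A B = (INF a\<in>A. INF b\<in>B. ennreal (mdist m a b))"

definition set_diam :: "'a metric \<Rightarrow> 'a set \<Rightarrow> ennreal" where
  "set_diam m A = (SUP a\<in>A. SUP b\<in>A. ennreal (mdist m a b))"

definition neighborhood :: "'a metric \<Rightarrow> real \<Rightarrow> 'a set \<Rightarrow> 'a set" where
  "neighborhood m r A = {p \<in> mspace m. set_dist m {p} A \<le> ennreal r}"

definition Hausdorff_distance :: "'a metric \<Rightarrow> 'a set \<Rightarrow> 'a set \<Rightarrow> ennreal" where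
  "Hausdorff_distance m A B =
     max (SUP a\<in>A. set_dist m {a} B) (SUP b\<in>B. set_dist m {b} A)"


section \<open>Geodesics, hyperbolicity and coarse notions\<close>

definition geodesic_segment :: "'a metric \<Rightarrow> 'a \<Rightarrow> 'a \<Rightarrow> 'a set \<Rightarrow> bool" where
  "geodesic_segment m x y g \<longleftrightarrow>
     (\<exists>\<gamma> L. 0 \<le> L \<and> \<gamma> \<in> {0..L} \<rightarrow> mspace m \<and> \<gamma> 0 = x \<and> \<gamma> L = y \<and>
        (\<forall>s\<in>{0..L}. \<forall>t\<in>{0..L}. mdist m (\<gamma> s) (\<gamma> t) = \<bar>s - t\<bar>) \<and> g = \<gamma> ` {0..L})"

definition geodesic_space :: "'a metric \<Rightarrow> bool" where
  "geodesic_space m \<longleftrightarrow> (\<forall>x\<in>mspace m. \<forall>y\<in>mspace m. \<exists>g. geodesic_segment m x y g)"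

text \<open>Hyperbolicity of a geodesic space in the sense of Rips: triangles are \<open>\<delta>\<close>-slim.\<close>

definition hyperbolic_geodesic_space :: "real \<Rightarrow> 'a metric \<Rightarrow> bool" where
  "hyperbolic_geodesic_space \<delta> m \<longleftrightarrow> geodesic_space m \<and>
     (\<forall>x y z g h k. geodesic_segment m x y g \<and> geodesic_segment m y z h \<and> geodesic_segment m z x k
        \<longrightarrow> g \<subseteq> neighborhood m \<delta> (h \<union> k))"

definition geodesic_hull :: "'a metric \<Rightarrow> 'a set \<Rightarrow> 'a set" where
  "geodesic_hull m B = \<Union>{g. \<exists>x\<in>B. \<exists>y\<in>B. geodesic_segment m x y g}"

definition quasiconvex :: "real \<Rightarrow> 'a metric \<Rightarrow> 'a set \<Rightarrow> bool" where
  "quasiconvex K m Y \<longleftrightarrow>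
     (\<forall>x\<in>Y. \<forall>y\<in>Y. \<forall>g. geodesic_segment m x y g \<longrightarrow> g \<subseteq> neighborhood m K Y)"

definition quasigeodesic_space :: "real \<Rightarrow> 'a metric \<Rightarrow> bool" where
  "quasigeodesic_space q m \<longleftrightarrow> q \<ge> 1 \<and>
     (\<forall>x\<in>mspace m. \<forall>y\<in>mspace m. \<exists>\<gamma> L. 0 \<le> L \<and> \<gamma> \<in> {0..L} \<rightarrow> mspace m \<and> \<gamma> 0 = x \<and> \<gamma> L = y \<and>
        (\<forall>s\<in>{0..L}. \<forall>t\<in>{0..L}. \<bar>s - t\<bar> / q - q \<le> mdist m (\<gamma> s) (\<gamma> t) \<and>
                               mdist m (\<gamma> s) (\<gamma> t) \<le> q * \<bar>s - t\<bar> + q))"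

definition coarsely_Lipschitz_on :: "real \<Rightarrow> real \<Rightarrow> 'a metric \<Rightarrow> 'b metric \<Rightarrow> ('a \<Rightarrow> 'b) \<Rightarrow> bool" where
  "coarsely_Lipschitz_on K L m n f \<longleftrightarrow>
     (\<forall>x\<in>mspace m. \<forall>y\<in>mspace m. mdist n (f x) (f y) \<le> K * mdist m x y + L)"

definition set_coarsely_Lipschitz_on ::
    "real \<Rightarrow> real \<Rightarrow> 'a metric \<Rightarrow> 'b metric \<Rightarrow> ('a \<Rightarrow> 'b set) \<Rightarrow> bool" where
  "set_coarsely_Lipschitz_on K L m n f \<longleftrightarrow>
     (\<forall>x\<in>mspace m. \<forall>y\<in>mspace m. set_dist n (f x) (f y) \<le> ennreal (K * mdist m x y + L))"


section \<open>Hierarchically hyperbolic spaces\<close>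

text \<open>
  The data of a structure on a space with points in \<open>'x\<close>. The spaces \<open>\<C>W\<close> have carriers in a common
  type \<open>'c\<close>; the carriers for different \<open>W\<close> are unrelated.
  \<^item> \<open>proj \<SS> W\<close> is \<open>\<pi>\<^sub>W\<close>;
  \<^item> \<open>rho_set \<SS> V W\<close> is the subset \<open>\<rho>\<close> of \<open>\<C>W\<close> with superscript \<open>V\<close> and subscript \<open>W\<close>, meaningful
    if \<open>V\<close> is properly nested in, or transverse to, \<open>W\<close>;
  \<^item> \<open>rho_map \<SS> W V\<close> is the map \<open>\<rho>\<close> from \<open>\<C>W\<close> to subsets of \<open>\<C>V\<close> with superscript \<open>W\<close> and subscript
    \<open>V\<close>, meaningful if \<open>V\<close> is properly nested in \<open>W\<close>.
\<close>

record ('x, 'i, 'c) hhs_structure =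
  index :: "'i set"
  cspace :: "'i \<Rightarrow> 'c metric"
  nest :: "('i \<times> 'i) set"
  orth :: "('i \<times> 'i) set"
  proj :: "'i \<Rightarrow> 'x \<Rightarrow> 'c set"
  rho_set :: "'i \<Rightarrow> 'i \<Rightarrow> 'c set"
  rho_map :: "'i \<Rightarrow> 'i \<Rightarrow> 'c \<Rightarrow> 'c set"

definition pnested :: "('x, 'i, 'c) hhs_structure \<Rightarrow> 'i \<Rightarrow> 'i \<Rightarrow> bool" where
  "pnested \<SS> V W \<longleftrightarrow> (V, W) \<in> nest \<SS> \<and> V \<noteq> W"

definition transverse :: "('x, 'i, 'c) hhs_structure \<Rightarrow> 'i \<Rightarrow> 'i \<Rightarrow> bool" where
  "transverse \<SS> V W \<longleftrightarrow> V \<in> index \<SS> \<and> W \<in> index \<SS> \<and>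
     (V, W) \<notin> orth \<SS> \<and> (V, W) \<notin> nest \<SS> \<and> (W, V) \<notin> nest \<SS>"

definition nested_in :: "('x, 'i, 'c) hhs_structure \<Rightarrow> 'i \<Rightarrow> 'i set" where
  "nested_in \<SS> W = {V \<in> index \<SS>. (V, W) \<in> nest \<SS>}"

definition proj_set :: "('x, 'i, 'c) hhs_structure \<Rightarrow> 'i \<Rightarrow> 'x set \<Rightarrow> 'c set" where
  "proj_set \<SS> W A = (\<Union>a\<in>A. proj \<SS> W a)"

definition pdist :: "('x, 'i, 'c) hhs_structure \<Rightarrow> 'i \<Rightarrow> 'x \<Rightarrow> 'x \<Rightarrow> ennreal" where
  "pdist \<SS> W x y = set_dist (cspace \<SS> W) (proj \<SS> W x) (proj \<SS> W y)"

definition pdist_set :: "('x, 'i, 'c) hhs_structure \<Rightarrow> 'i \<Rightarrow> 'x \<Rightarrow> 'c set \<Rightarrow> ennreal" where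
  "pdist_set \<SS> W x P = set_dist (cspace \<SS> W) (proj \<SS> W x) P"

definition rho_image :: "('x, 'i, 'c) hhs_structure \<Rightarrow> 'i \<Rightarrow> 'i \<Rightarrow> 'c set \<Rightarrow> 'c set" where
  "rho_image \<SS> W V P = (\<Union>p\<in>P. rho_map \<SS> W V p)"

definition hhs_projections ::
    "'x metric \<Rightarrow> ('x, 'i, 'c) hhs_structure \<Rightarrow> real \<Rightarrow> real \<Rightarrow> bool" where
  "hhs_projections X \<SS> \<xi> K \<longleftrightarrow> 0 \<le> \<xi> \<and> 0 \<le> K \<and>
     (\<forall>W\<in>index \<SS>.
        (\<forall>x\<in>mspace X. proj \<SS> W x \<subseteq> mspace (cspace \<SS> W) \<and> proj \<SS> W x \<noteq> {} \<and>
           set_diam (cspace \<SS> W) (proj \<SS> W x) \<le> ennreal \<xi>) \<and>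
        set_coarsely_Lipschitz_on K K X (cspace \<SS> W) (proj \<SS> W) \<and>
        quasiconvex K (cspace \<SS> W) (proj_set \<SS> W (mspace X)))"

text \<open>The values of \<^const>\<open>rho_map\<close> are required to be nonempty, as is implicit in calling it a
  (coarse) map: a map with empty values would satisfy the consistency and bounded geodesic image
  conditions vacuously. For \<^const>\<open>rho_set\<close>, nonemptiness follows from partial realization, since
  the distance to the empty set is \<open>\<infinity>\<close>.\<close>

definition hhs_nesting :: "('x, 'i, 'c) hhs_structure \<Rightarrow> real \<Rightarrow> bool" where
  "hhs_nesting \<SS> \<xi> \<longleftrightarrow>
     partial_order_on (index \<SS>) (nest \<SS>) \<and>
     (index \<SS> = {} \<or> (\<exists>!S. S \<in> index \<SS> \<and> (\<forall>W\<in>index \<SS>. (S, W) \<in> nest \<SS> \<longrightarrow> W = S))) \<and>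
     (\<forall>V W. pnested \<SS> V W \<longrightarrow>
        rho_set \<SS> V W \<subseteq> mspace (cspace \<SS> W) \<and>
        set_diam (cspace \<SS> W) (rho_set \<SS> V W) \<le> ennreal \<xi> \<and>
        (\<forall>p\<in>mspace (cspace \<SS> W).
           rho_map \<SS> W V p \<subseteq> mspace (cspace \<SS> V) \<and> rho_map \<SS> W V p \<noteq> {}))"

definition hhs_orthogonality :: "('x, 'i, 'c) hhs_structure \<Rightarrow> bool" where
  "hhs_orthogonality \<SS> \<longleftrightarrow>
     orth \<SS> \<subseteq> index \<SS> \<times> index \<SS> \<and> sym (orth \<SS>) \<and> irrefl (orth \<SS>) \<and>
     (\<forall>U V W. (V, W) \<in> nest \<SS> \<and> (W, U) \<in> orth \<SS> \<longrightarrow> (V, U) \<in> orth \<SS>) \<and>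
     (\<forall>T\<in>index \<SS>. \<forall>U\<in>nested_in \<SS> T. {V \<in> nested_in \<SS> T. (V, U) \<in> orth \<SS>} \<noteq> {} \<longrightarrow>
        (\<exists>W\<in>nested_in \<SS> T - {T}. \<forall>V. (V, U) \<in> orth \<SS> \<and> (V, T) \<in> nest \<SS> \<longrightarrow> (V, W) \<in> nest \<SS>)) \<and>
     (\<forall>V W. (V, W) \<in> orth \<SS> \<longrightarrow> (V, W) \<notin> nest \<SS> \<and> (W, V) \<notin> nest \<SS>)"

definition hhs_consistency ::
    "'x metric \<Rightarrow> ('x, 'i, 'c) hhs_structure \<Rightarrow> real \<Rightarrow> real \<Rightarrow> bool" where
  "hhs_consistency X \<SS> \<xi> \<kappa>\<^sub>0 \<longleftrightarrow> 0 \<le> \<kappa>\<^sub>0 \<and>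
     (\<forall>V W. transverse \<SS> V W \<longrightarrow>
        rho_set \<SS> V W \<subseteq> mspace (cspace \<SS> W) \<and>
        set_diam (cspace \<SS> W) (rho_set \<SS> V W) \<le> ennreal \<xi> \<and>
        rho_set \<SS> W V \<subseteq> mspace (cspace \<SS> V) \<and>
        set_diam (cspace \<SS> V) (rho_set \<SS> W V) \<le> ennreal \<xi> \<and>
        (\<forall>x\<in>mspace X. min (pdist_set \<SS> W x (rho_set \<SS> V W)) (pdist_set \<SS> V x (rho_set \<SS> W V))
                        \<le> ennreal \<kappa>\<^sub>0)) \<and>
     (\<forall>V W. pnested \<SS> V W \<longrightarrow>
        (\<forall>x\<in>mspace X. min (pdist_set \<SS> W x (rho_set \<SS> V W))
            (set_diam (cspace \<SS> V) (proj \<SS> V x \<union> rho_image \<SS> W V (proj \<SS> W x))) \<le> ennreal \<kappa>\<^sub>0)) \<and>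
     (\<forall>U V W. (U, V) \<in> nest \<SS> \<and>
          (pnested \<SS> V W \<or> (transverse \<SS> V W \<and> (W, U) \<notin> orth \<SS>)) \<longrightarrow>
        set_dist (cspace \<SS> W) (rho_set \<SS> U W) (rho_set \<SS> V W) \<le> ennreal \<kappa>\<^sub>0)"

definition hhs_finite_complexity :: "('x, 'i, 'c) hhs_structure \<Rightarrow> bool" where
  "hhs_finite_complexity \<SS> \<longleftrightarrow>
     (\<exists>n. \<forall>\<V>\<subseteq>index \<SS>. (\<forall>V\<in>\<V>. \<forall>W\<in>\<V>. (V, W) \<in> nest \<SS> \<or> (W, V) \<in> nest \<SS>) \<longrightarrow>
        finite \<V> \<and> card \<V> \<le> n)"

definition hhs_large_links ::
    "'x metric \<Rightarrow> ('x, 'i, 'c) hhs_structure \<Rightarrow> real \<Rightarrow> real \<Rightarrow> bool" where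
  "hhs_large_links X \<SS> \<xi> \<kappa>\<^sub>0 \<longleftrightarrow>
     (\<exists>l\<ge>1. \<exists>E\<ge>max \<xi> \<kappa>\<^sub>0. \<forall>W\<in>index \<SS>. \<forall>x\<in>mspace X. \<forall>x'\<in>mspace X.
        let N = l * enn2real (pdist \<SS> W x x') + l in
          \<exists>\<T>\<subseteq>nested_in \<SS> W - {W}. finite \<T> \<and> int (card \<T>) \<le> \<lfloor>N\<rfloor> \<and>
            (\<forall>T\<in>nested_in \<SS> W - {W}.
               (\<exists>T'\<in>\<T>. T \<in> nested_in \<SS> T') \<or> pdist \<SS> T x x' < ennreal E) \<and>
            (\<forall>T'\<in>\<T>. pdist_set \<SS> W x (rho_set \<SS> T' W) \<le> ennreal N))"

definition hhs_bounded_geodesic_image :: "('x, 'i, 'c) hhs_structure \<Rightarrow> bool" where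
  "hhs_bounded_geodesic_image \<SS> \<longleftrightarrow>
     (\<exists>E>0. \<forall>V W x y g. pnested \<SS> V W \<and> geodesic_segment (cspace \<SS> W) x y g \<longrightarrow>
        set_diam (cspace \<SS> V) (rho_image \<SS> W V g) \<le> ennreal E \<or>
        g \<inter> neighborhood (cspace \<SS> W) E (rho_set \<SS> V W) \<noteq> {})"

text \<open>As orthogonality is irreflexive, a pairwise orthogonal family has no repetitions
  and is represented by its set \<open>\<V>\<close> of members.\<close>

definition hhs_partial_realization ::
    "'x metric \<Rightarrow> ('x, 'i, 'c) hhs_structure \<Rightarrow> bool" where
  "hhs_partial_realization X \<SS> \<longleftrightarrow>
     (\<exists>\<alpha>::real. \<forall>\<V>\<subseteq>index \<SS>. \<forall>p. (\<forall>V\<in>\<V>. \<forall>W\<in>\<V>. V \<noteq> W \<longrightarrow> (V, W) \<in> orth \<SS>) \<and>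
          (\<forall>V\<in>\<V>. p V \<in> proj_set \<SS> V (mspace X)) \<longrightarrow>
        (\<exists>x\<in>mspace X. \<forall>V\<in>\<V>. pdist_set \<SS> V x {p V} \<le> ennreal \<alpha> \<and>
           (\<forall>W. pnested \<SS> V W \<or> transverse \<SS> W V \<longrightarrow>
              pdist_set \<SS> W x (rho_set \<SS> V W) \<le> ennreal \<alpha>)))"

definition hhs_uniqueness :: "'x metric \<Rightarrow> ('x, 'i, 'c) hhs_structure \<Rightarrow> bool" where
  "hhs_uniqueness X \<SS> \<longleftrightarrow>
     (\<forall>\<kappa>\<ge>0. \<exists>\<theta>\<^sub>u. \<forall>x\<in>mspace X. \<forall>y\<in>mspace X.
        mdist X x y \<ge> \<theta>\<^sub>u \<longrightarrow> (\<exists>V\<in>index \<SS>. pdist \<SS> V x y \<ge> ennreal \<kappa>))"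

definition hierarchically_hyperbolic_space ::
    "'x metric \<Rightarrow> ('x, 'i, 'c) hhs_structure \<Rightarrow> bool" where
  "hierarchically_hyperbolic_space X \<SS> \<longleftrightarrow>
     (\<exists>q. quasigeodesic_space q X) \<and>
     (\<exists>\<delta>\<ge>0. \<forall>W\<in>index \<SS>. hyperbolic_geodesic_space \<delta> (cspace \<SS> W)) \<and>
     (\<exists>\<xi> K \<kappa>\<^sub>0. hhs_projections X \<SS> \<xi> K \<and> hhs_nesting \<SS> \<xi> \<and> hhs_orthogonality \<SS> \<and>
        hhs_consistency X \<SS> \<xi> \<kappa>\<^sub>0 \<and> hhs_finite_complexity \<SS> \<and> hhs_large_links X \<SS> \<xi> \<kappa>\<^sub>0 \<and>
        hhs_bounded_geodesic_image \<SS> \<and> hhs_partial_realization X \<SS> \<and> hhs_uniqueness X \<SS>)"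

definition H_theta ::
    "'x metric \<Rightarrow> ('x, 'i, 'c) hhs_structure \<Rightarrow> real \<Rightarrow> 'x set \<Rightarrow> 'x set" where
  "H_theta X \<SS> \<theta> A = {p \<in> mspace X. \<forall>W\<in>index \<SS>.
     pdist_set \<SS> W p (geodesic_hull (cspace \<SS> W) (proj_set \<SS> W A)) \<le> ennreal \<theta>}"

end

theory Submission
  imports Defs
begin

text \<open>In each \<open>\<C>W\<close> project \<open>x\<close> to the hull of \<open>\<pi>\<^sub>W(A)\<close>. These projections form a consistent tuple: a point
  of \<open>A\<close> and \<open>x\<close> itself satisfy the consistency inequalities, and the hull is quasiconvex. The tuple
  differs significantly from the coordinates of any given point in only finitely many domains, by
  the large links axiom; this makes it possible to realize it by a point \<open>r\<^sub>A(x)\<close>. Start with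
  the empty family of orthogonal domains. Partial realization gives a point with the right coordinates
  on the family; among the domains where this point is still wrong take the \<open>\<sqsubseteq>\<close>-maximal ones, and
  among these one that is closest to the tuple with respect to the order on transverse domains. With
  this domain the family can be enlarged, or refined, and finite complexity bounds the number of steps.

  By uniqueness, bounded changes of \<open>x\<close> and \<open>A\<close> move \<open>r\<^sub>A(x)\<close> by a bounded amount. Both Lipschitz
  estimates follow by subdividing: \<open>x\<close> is moved to \<open>x'\<close>, and all points of \<open>A\<close> simultaneously to \<open>A'\<close>,
  along quasigeodesics; so the distance formula is not needed.\<close>

section \<open>Hulls in hyperbolic spaces\<close>

text \<open>The difficulty is uniformity. At a given point only finitely many domains are wrong, but
  no constant of the space bounds their number, so correcting them one by one would give no uniform
  error. Finiteness serves only to find maximal and minimal elements. The error is controlled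
  because each change of the orthogonal family costs the same additive amount, while the number of
  changes is bounded by the complexity alone.

  The points of H_theta(A) must be fixed, so there r_A is not given by the realization. They are,
  however, gates of themselves with a tolerance depending on theta. Comparing all gates at one
  common tolerance treats both kinds of values alike: neighbouring points, or neighbouring sets,
  have gates at bounded distance. A linear estimate then only needs a linear bound on the number of
  subdivision steps.

  Infima over sets and nearest points are not attained in general; this is the source of most
  summands 1.\<close>

lemma mdist_self: "x \<in> mspace m \<Longrightarrow> mdist m x x = 0"
  by simp

lemma geodesic_segment_sym:
  assumes "geodesic_segment m x y g"
  shows "geodesic_segment m y x g"
proof -
  obtain \<gamma> L where L: "0 \<le> L" "\<gamma> \<in> {0..L} \<rightarrow> mspace m" "\<gamma> 0 = x" "\<gamma> L = y"
    and iso: "\<And>s t. s \<in> {0..L} \<Longrightarrow> t \<in> {0..L} \<Longrightarrow> mdist m (\<gamma> s) (\<gamma> t) = \<bar>s - t\<bar>"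
    and g: "g = \<gamma> ` {0..L}"
    using assms unfolding geodesic_segment_def by blast
  have "(\<lambda>t. L - t) ` {0..L} = {0..L}"
    using L(1) image_diff_atLeastAtMost[of L 0 L] by simp
  then have "g = (\<lambda>t. \<gamma> (L - t)) ` {0..L}"
    unfolding g by (metis image_image)
  moreover have "mdist m (\<gamma> (L - s)) (\<gamma> (L - t)) = \<bar>s - t\<bar>" if "s \<in> {0..L}" "t \<in> {0..L}" for s t
    using iso[of "L - s" "L - t"] that by auto
  ultimately show ?thesis
    unfolding geodesic_segment_def
    using L by (intro exI[of _ "\<lambda>t. \<gamma> (L - t)"] exI[of _ L]) auto
qed

lemma geodesic_segment_in: "geodesic_segment m x y g \<Longrightarrow> z \<in> g \<Longrightarrow> z \<in> mspace m"
  unfolding geodesic_segment_def by auto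

lemma geodesic_segment_ends:
  assumes "geodesic_segment m x y g"
  shows "x \<in> g" "y \<in> g"
  using assms unfolding geodesic_segment_def by force+

lemma geodesic_segment_refl: "x \<in> mspace m \<Longrightarrow> geodesic_segment m x x {x}"
  unfolding geodesic_segment_def by (intro exI[of _ "\<lambda>_. x"] exI[of _ 0]) auto

lemma geodesic_segment_split:
  assumes "geodesic_segment m x y g" "z \<in> g"
  obtains g1 g2 where "geodesic_segment m x z g1" "geodesic_segment m z y g2" "g1 \<subseteq> g" "g2 \<subseteq> g"
    "\<And>u v. u \<in> g1 \<Longrightarrow> v \<in> g2 \<Longrightarrow> mdist m u v = mdist m u z + mdist m z v"
proof -
  obtain \<gamma> L where L: "0 \<le> L" "\<gamma> \<in> {0..L} \<rightarrow> mspace m" "\<gamma> 0 = x" "\<gamma> L = y"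
    and iso: "\<And>s t. s \<in> {0..L} \<Longrightarrow> t \<in> {0..L} \<Longrightarrow> mdist m (\<gamma> s) (\<gamma> t) = \<bar>s - t\<bar>"
    and g: "g = \<gamma> ` {0..L}"
    using assms unfolding geodesic_segment_def by blast
  obtain r where r: "r \<in> {0..L}" "z = \<gamma> r" using assms(2) g by blast
  have 1: "geodesic_segment m x z (\<gamma> ` {0..r})"
    unfolding geodesic_segment_def
    using L r iso by (intro exI[of _ \<gamma>] exI[of _ r]) (auto simp: Pi_iff)
  have "(\<lambda>t. t + r) ` {0..L - r} = {r..L}"
    using r image_add_atLeastAtMost'[of r 0 "L - r"] by simp
  then have im: "\<gamma> ` {r..L} = (\<lambda>t. \<gamma> (t + r)) ` {0..L - r}"
    by (metis image_image)
  have 2: "geodesic_segment m z y (\<gamma> ` {r..L})"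
    unfolding geodesic_segment_def im
    using L r iso[of "_ + r" "_ + r"]
    by (intro exI[of _ "\<lambda>t. \<gamma> (t + r)"] exI[of _ "L - r"]) (auto simp: Pi_iff)
  have 3: "mdist m u v = mdist m u z + mdist m z v" if "u \<in> \<gamma> ` {0..r}" "v \<in> \<gamma> ` {r..L}" for u v
    using that r by (auto simp: iso)
  show ?thesis
    using that[OF 1 2] 3 r by (auto simp: g image_mono)
qed

lemma geodesic_segment_dist:
  assumes "geodesic_segment m x y g" "z \<in> g"
  shows "mdist m x y = mdist m x z + mdist m z y"
  using geodesic_segment_split[OF assms] geodesic_segment_ends by metis

lemma geodesic_hullI: "geodesic_segment m x y g \<Longrightarrow> x \<in> B \<Longrightarrow> y \<in> B \<Longrightarrow> z \<in> g \<Longrightarrow> z \<in> geodesic_hull m B"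
  unfolding geodesic_hull_def by blast

lemma geodesic_hullE:
  assumes "z \<in> geodesic_hull m B"
  obtains x y g where "x \<in> B" "y \<in> B" "geodesic_segment m x y g" "z \<in> g"
  using assms unfolding geodesic_hull_def by blast

lemma geodesic_hull_in: "z \<in> geodesic_hull m B \<Longrightarrow> z \<in> mspace m"
  by (auto elim: geodesic_hullE dest: geodesic_segment_in)

lemma subset_geodesic_hull: "B \<subseteq> mspace m \<Longrightarrow> B \<subseteq> geodesic_hull m B"
  using geodesic_segment_refl geodesic_hullI by fastforce

lemma geodesic_hull_mono: "B \<subseteq> B' \<Longrightarrow> geodesic_hull m B \<subseteq> geodesic_hull m B'"
  unfolding geodesic_hull_def by blast

text \<open>A geodesic with both ends within \<open>r\<close> of \<open>c\<close> has length at most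
  \<open>2 * r\<close>; the third \<open>r\<close> leads from an end to \<open>c\<close>.\<close>

lemma geodesic_hull_bounded:
  assumes B: "B \<subseteq> mspace m" and c: "c \<in> mspace m" and r: "\<And>p. p \<in> B \<Longrightarrow> mdist m p c \<le> r"
    and z: "z \<in> geodesic_hull m B"
  shows "mdist m z c \<le> 3 * r"
proof -
  obtain x y g where g: "x \<in> B" "y \<in> B" "geodesic_segment m x y g" "z \<in> g"
    using z by (rule geodesic_hullE)
  have in_m: "x \<in> mspace m" "y \<in> mspace m" "z \<in> mspace m"
    using g B by (auto dest: geodesic_segment_in)
  have "mdist m z c \<le> mdist m z x + mdist m x c" "mdist m x y \<le> mdist m x c + mdist m c y"
    using in_m c by (auto intro: mdist_triangle)
  then show ?thesis
    using geodesic_segment_dist[OF g(3,4)] r[OF g(1)] r[OF g(2)] mdist_nonneg[of m z y]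
      mdist_commute[of m z x] mdist_commute[of m c y] by linarith
qed

text \<open>The slack 1 replaces a nearest point, which may fail to exist because \<open>Y\<close>
  need not be closed nor the space proper. It is a relation because such points are not
  unique.\<close>

definition near_projection :: "'a metric \<Rightarrow> 'a set \<Rightarrow> 'a \<Rightarrow> 'a \<Rightarrow> bool" where
  "near_projection m Y x p \<longleftrightarrow> p \<in> Y \<and> (\<forall>y\<in>Y. mdist m x p \<le> mdist m x y + 1)"

lemma near_projection_exists:
  assumes "Y \<noteq> {}"
  obtains p where "near_projection m Y x p"
proof -
  let ?I = "INF y\<in>Y. mdist m x y"
  have bdd: "bdd_below (mdist m x ` Y)" by (rule bdd_belowI2[of _ 0]) simp
  have "?I < ?I + 1" by simp
  then obtain p where p: "p \<in> Y" "mdist m x p < ?I + 1"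
    using cINF_less_iff[OF assms bdd] by blast
  moreover have "mdist m x p \<le> mdist m x y + 1" if "y \<in> Y" for y
    using cINF_lower[OF bdd that] p(2) by simp
  ultimately show ?thesis using that unfolding near_projection_def by blast
qed

text \<open>Slimness with an actual witness \<open>v\<close> instead of an infimum over the other
  two sides; the additive cost is absorbed in \<open>D\<close>.\<close>

locale slim_space =
  fixes m :: "'a metric" and D :: real
  assumes geodesic: "geodesic_space m"
    and slim: "\<lbrakk>geodesic_segment m x y g; geodesic_segment m y z h; geodesic_segment m z x k; u \<in> g\<rbrakk>
      \<Longrightarrow> \<exists>v\<in>h \<union> k. mdist m u v \<le> D"
begin

lemma segment_exists:
  assumes "x \<in> mspace m" "y \<in> mspace m"
  obtains g where "geodesic_segment m x y g"
  using geodesic assms unfolding geodesic_space_def by blast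

lemma D_nonneg:
  assumes "x \<in> mspace m"
  shows "0 \<le> D"
proof -
  have "geodesic_segment m x x {x}" by (rule geodesic_segment_refl[OF assms])
  then have "mdist m x x \<le> D" using slim[of x x "{x}" x "{x}" "{x}" x] by auto
  then show ?thesis using mdist_nonneg[of m x x] by linarith
qed

text \<open>Let \<open>x\<close> be an end of a generating segment through \<open>q\<close>. In the
  triangle \<open>p q x\<close> the sides from \<open>x\<close> lie in the hull, so slimness moves
  the third side into it.\<close>

lemma hull_quasiconvex_point:
  assumes B: "B \<subseteq> mspace m" and p: "p \<in> B" and q: "q \<in> geodesic_hull m B"
    and g: "geodesic_segment m p q g" and u: "u \<in> g"
  obtains v where "v \<in> geodesic_hull m B" "mdist m u v \<le> D"
proof -
  obtain x y k where k: "x \<in> B" "y \<in> B" "geodesic_segment m x y k" "q \<in> k"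
    using q by (rule geodesic_hullE)
  obtain k1 k2 where k1: "geodesic_segment m x q k1" "k1 \<subseteq> k"
    using geodesic_segment_split[OF k(3,4)] by metis
  obtain l where l: "geodesic_segment m x p l"
    using segment_exists k(1) p B by (metis subsetD)
  obtain v where "v \<in> k1 \<union> l" "mdist m u v \<le> D"
    using slim[OF g geodesic_segment_sym[OF k1(1)] l u] by blast
  then show ?thesis
    using that k1(2) geodesic_hullI[OF k(3,1,2)] geodesic_hullI[OF l k(1) p] by blast
qed

text \<open>In the triangle with corners \<open>p\<close>, \<open>q\<close> and an end
  \<open>x\<close> of a segment generating \<open>p\<close>, the side from \<open>x\<close> to
  \<open>p\<close> lies in the hull. The side from \<open>x\<close> to \<open>q\<close> starts in
  \<open>B\<close>, so the preceding lemma moves it there at a second cost \<open>D\<close>.\<close>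

lemma hull_quasiconvex:
  assumes B: "B \<subseteq> mspace m" and p: "p \<in> geodesic_hull m B" and q: "q \<in> geodesic_hull m B"
    and g: "geodesic_segment m p q g" and u: "u \<in> g"
  obtains v where "v \<in> geodesic_hull m B" "mdist m u v \<le> 2 * D"
proof -
  obtain x y k where k: "x \<in> B" "y \<in> B" "geodesic_segment m x y k" "p \<in> k"
    using p by (rule geodesic_hullE)
  obtain k1 k2 where k1: "geodesic_segment m x p k1" "k1 \<subseteq> k"
    using geodesic_segment_split[OF k(3,4)] by metis
  have q_in: "q \<in> mspace m" using q by (auto dest: geodesic_hull_in)
  obtain l where l: "geodesic_segment m x q l"
    using segment_exists k(1) q_in B by (metis subsetD)
  obtain w where w: "w \<in> l \<union> k1" "mdist m u w \<le> D"
    using slim[OF g geodesic_segment_sym[OF l] k1(1) u] by blast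
  have in_m: "u \<in> mspace m" "w \<in> mspace m"
    using u g w(1) l k1(1) by (auto dest: geodesic_segment_in)
  show ?thesis
  proof (cases "w \<in> l")
    case True
    obtain v where v: "v \<in> geodesic_hull m B" "mdist m w v \<le> D"
      using hull_quasiconvex_point[OF B k(1) q l True] by blast
    have "mdist m u v \<le> mdist m u w + mdist m w v"
      using in_m v(1) by (auto intro: mdist_triangle dest: geodesic_hull_in)
    then show ?thesis using that v w(2) by fastforce
  next
    case False
    then have "w \<in> geodesic_hull m B"
      using w(1) k1(2) geodesic_hullI[OF k(3,1,2)] by blast
    moreover have "mdist m u w \<le> 2 * D" using w(2) D_nonneg[OF in_m(1)] by linarith
    ultimately show ?thesis using that by blast
  qed
qed

text \<open>Cut the quadrilateral \<open>p q q' p'\<close> along the diagonal from \<open>q'\<close>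
  to \<open>p\<close>. Two slim triangles move \<open>u\<close> either to the side from
  \<open>p'\<close> to \<open>q'\<close>, which is in the hull, or to a side of length at most
  \<open>r\<close> that ends in \<open>B'\<close>.\<close>

lemma hull_close:
  assumes B: "B \<subseteq> mspace m" and B': "B' \<subseteq> mspace m"
    and close: "\<And>p. p \<in> B \<Longrightarrow> \<exists>p'\<in>B'. mdist m p p' \<le> r" and u: "u \<in> geodesic_hull m B"
  obtains v where "v \<in> geodesic_hull m B'" "mdist m u v \<le> r + 2 * D"
proof -
  obtain p q g where g: "p \<in> B" "q \<in> B" "geodesic_segment m p q g" "u \<in> g"
    using u by (rule geodesic_hullE)
  obtain p' where p': "p' \<in> B'" "mdist m p p' \<le> r" using close[OF g(1)] by blast
  obtain q' where q': "q' \<in> B'" "mdist m q q' \<le> r" using close[OF g(2)] by blast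
  have in_m: "p \<in> mspace m" "q \<in> mspace m" "p' \<in> mspace m" "q' \<in> mspace m" "u \<in> mspace m"
    using g p' q' B B' by (auto dest: geodesic_segment_in)
  obtain a where a: "geodesic_segment m q q' a" using segment_exists in_m by metis
  obtain b where b: "geodesic_segment m q' p b" using segment_exists in_m by metis
  obtain c where c: "geodesic_segment m p p' c" using segment_exists in_m by metis
  obtain d where d: "geodesic_segment m p' q' d" using segment_exists in_m by metis
  have hull: "p' \<in> geodesic_hull m B'" "q' \<in> geodesic_hull m B'"
    using subset_geodesic_hull[OF B'] p'(1) q'(1) by blast+
  have D0: "0 \<le> D" using D_nonneg in_m by blast
  have r0: "0 \<le> r" using p'(2) mdist_nonneg[of m p p'] by linarith
  obtain w where w: "w \<in> a \<union> b" "mdist m u w \<le> D"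
    using slim[OF g(3) a b g(4)] by blast
  have wm: "w \<in> mspace m" using w(1) a b by (auto dest: geodesic_segment_in)
  show ?thesis
  proof (cases "w \<in> a")
    case True
    have "mdist m w q' \<le> r"
      using geodesic_segment_dist[OF a True] q'(2) mdist_nonneg[of m q w] by linarith
    moreover have "mdist m u q' \<le> mdist m u w + mdist m w q'"
      using in_m wm by (auto intro: mdist_triangle)
    ultimately show ?thesis using that[OF hull(2)] w(2) D0 by linarith
  next
    case False
    then have "w \<in> b" using w(1) by blast
    then obtain v where v: "v \<in> c \<union> d" "mdist m w v \<le> D"
      using slim[OF b c d] by blast
    have vm: "v \<in> mspace m" using v(1) c d by (auto dest: geodesic_segment_in)
    have uv: "mdist m u v \<le> 2 * D"
      using mdist_triangle[of u m w v] in_m(5) wm vm w(2) v(2) by simp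
    show ?thesis
    proof (cases "v \<in> c")
      case True
      have "mdist m v p' \<le> r"
        using geodesic_segment_dist[OF c True] p'(2) mdist_nonneg[of m p v] by linarith
      moreover have "mdist m u p' \<le> mdist m u v + mdist m v p'"
        using in_m vm by (auto intro: mdist_triangle)
      ultimately show ?thesis using that[OF hull(1)] uv by linarith
    next
      case False
      then have "v \<in> geodesic_hull m B'" using v(1) geodesic_hullI[OF d p'(1) q'(1)] by blast
      then show ?thesis using that uv r0 by fastforce
    qed
  qed
qed

text \<open>A midpoint of \<open>p\<close> and \<open>q\<close> is close to the hull and to a side of the triangle \<open>x p q\<close>,
  hence would be closer to \<open>x\<close> than \<open>p\<close> or \<open>q\<close> if these were far apart.\<close>

lemma almost_nearest_points_close:
  assumes B: "B \<subseteq> mspace m" and x: "x \<in> mspace m"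
    and p: "p \<in> geodesic_hull m B" "\<And>y. y \<in> geodesic_hull m B \<Longrightarrow> mdist m x p \<le> mdist m x y + c"
    and q: "q \<in> geodesic_hull m B" "\<And>y. y \<in> geodesic_hull m B \<Longrightarrow> mdist m x q \<le> mdist m x y + c"
  shows "mdist m p q \<le> 2 * c + 8 * D"
proof -
  have in_m: "p \<in> mspace m" "q \<in> mspace m" using p q by (auto dest: geodesic_hull_in)
  obtain g where g: "geodesic_segment m p q g" using segment_exists in_m by metis
  then obtain \<gamma> L where L: "0 \<le> L" "\<gamma> 0 = p" "\<gamma> L = q"
    and iso: "\<And>s t. s \<in> {0..L} \<Longrightarrow> t \<in> {0..L} \<Longrightarrow> mdist m (\<gamma> s) (\<gamma> t) = \<bar>s - t\<bar>"
    and g': "g = \<gamma> ` {0..L}"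
    unfolding geodesic_segment_def by blast
  define u where "u = \<gamma> (L / 2)"
  have u: "u \<in> g" using L(1) by (auto simp: u_def g')
  have um: "u \<in> mspace m" using u g by (auto dest: geodesic_segment_in)
  have pq: "mdist m p q = L" using iso[of 0 L] L by simp
  have pu: "mdist m p u = L / 2" using iso[of 0 "L/2"] L by (simp add: u_def)
  have qu: "mdist m q u = L / 2" using iso[of L "L/2"] L by (simp add: u_def)
  obtain v where v: "v \<in> geodesic_hull m B" "mdist m u v \<le> 2 * D"
    using hull_quasiconvex[OF B p(1) q(1) g u] by blast
  have vm: "v \<in> mspace m" using v(1) by (auto dest: geodesic_hull_in)
  obtain h where h: "geodesic_segment m q x h" using segment_exists in_m x by metis
  obtain k where k: "geodesic_segment m x p k" using segment_exists in_m x by metis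
  obtain w where w: "w \<in> h \<union> k" "mdist m u w \<le> D" using slim[OF g h k u] by blast
  have wm: "w \<in> mspace m" using w(1) h k by (auto dest: geodesic_segment_in)
  have xv: "mdist m x v \<le> mdist m x w + D + 2 * D"
  proof -
    have "mdist m x v \<le> mdist m x w + mdist m w v" "mdist m w v \<le> mdist m w u + mdist m u v"
      using x wm vm um by (auto intro: mdist_triangle)
    then show ?thesis using w(2) v(2) by (simp add: mdist_commute[of m w u])
  qed
  \<comment> \<open>As \<open>p\<close> is almost nearest, \<open>xv\<close> gives
    \<open>mdist m w p \<le> c + 3 * D\<close> for \<open>w\<close> on the side \<open>k\<close>, so
    half the distance from \<open>p\<close> to \<open>q\<close> is at most \<open>c + 4 * D\<close>.
    The side \<open>h\<close> is symmetric.\<close>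
  show ?thesis
  proof (cases "w \<in> k")
    case True
    have "mdist m p u \<le> mdist m p w + mdist m w u" using in_m um wm by (auto intro: mdist_triangle)
    then show ?thesis
      using geodesic_segment_dist[OF k True] p(2)[OF v(1)] xv pu w(2) pq
      by (simp add: mdist_commute[of m w u] mdist_commute[of m p w])
  next
    case False
    then have "w \<in> h" using w(1) by blast
    moreover have "mdist m q u \<le> mdist m q w + mdist m w u"
      using in_m um wm by (auto intro: mdist_triangle)
    ultimately show ?thesis
      using geodesic_segment_dist[OF h] q(2)[OF v(1)] xv qu w(2) pq
      by (simp add: mdist_commute[of m w u] mdist_commute[of m q x] mdist_commute[of m w x])
  qed
qed

text \<open>Replace \<open>p'\<close> by a close point \<open>q\<close> of the hull of
  \<open>B\<close>. It is almost nearest to \<open>x\<close>, hence close to \<open>p\<close> by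
  \<open>almost_nearest_points_close\<close>.\<close>

lemma near_projections_close:
  assumes B: "B \<subseteq> mspace m" "B' \<subseteq> mspace m" and x: "x \<in> mspace m" "x' \<in> mspace m"
    and xx': "mdist m x x' \<le> r"
    and BB': "\<And>p. p \<in> B \<Longrightarrow> \<exists>p'\<in>B'. mdist m p p' \<le> r"
    and B'B: "\<And>p. p \<in> B' \<Longrightarrow> \<exists>p'\<in>B. mdist m p p' \<le> r"
    and p: "near_projection m (geodesic_hull m B) x p"
    and p': "near_projection m (geodesic_hull m B') x' p'"
  shows "mdist m p p' \<le> 9 * r + 18 * D + 2"
proof -
  have hull: "p \<in> geodesic_hull m B" "p' \<in> geodesic_hull m B'"
    using p p' by (auto simp: near_projection_def)
  have in_m: "p \<in> mspace m" "p' \<in> mspace m" using hull by (auto dest: geodesic_hull_in)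
  have r0: "0 \<le> r" using xx' mdist_nonneg[of m x x'] by linarith
  have D0: "0 \<le> D" using D_nonneg x by blast
  obtain q where q: "q \<in> geodesic_hull m B" "mdist m p' q \<le> r + 2 * D"
    using hull_close[OF B(2,1) B'B hull(2)] by blast
  have qm: "q \<in> mspace m" using q(1) by (auto dest: geodesic_hull_in)
  \<comment> \<open>The slack consists of two changes between \<open>x\<close> and \<open>x'\<close>
    (\<open>r\<close> each), two changes of hull (\<open>r + 2 * D\<close> each) and the 1 of
    \<open>near_projection\<close>.\<close>
  have "mdist m x q \<le> mdist m x y + (4 * r + 4 * D + 1)" if y: "y \<in> geodesic_hull m B" for y
  proof -
    obtain z where z: "z \<in> geodesic_hull m B'" "mdist m y z \<le> r + 2 * D"
      using hull_close[OF B(1,2) BB' y] by blast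
    have yz: "y \<in> mspace m" "z \<in> mspace m" using y z(1) by (auto dest: geodesic_hull_in)
    have "mdist m x' p' \<le> mdist m x' z + 1" using p' z(1) by (simp add: near_projection_def)
    moreover have "mdist m x q \<le> mdist m x x' + mdist m x' q" "mdist m x' q \<le> mdist m x' p' + mdist m p' q"
      "mdist m x' z \<le> mdist m x' x + mdist m x z" "mdist m x z \<le> mdist m x y + mdist m y z"
      using x qm in_m yz by (auto intro: mdist_triangle)
    ultimately show ?thesis using xx' q(2) z(2) by (simp add: mdist_commute[of m x' x])
  qed
  moreover have "mdist m x p \<le> mdist m x y + (4 * r + 4 * D + 1)" if "y \<in> geodesic_hull m B" for y
    using p that r0 D0 by (force simp: near_projection_def)
  ultimately have "mdist m p q \<le> 2 * (4 * r + 4 * D + 1) + 8 * D"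
    using almost_nearest_points_close[OF B(1) x(1) hull(1) _ q(1)] by blast
  then have "mdist m p q \<le> 8 * r + 16 * D + 2" by (simp add: algebra_simps)
  moreover have "mdist m p p' \<le> mdist m p q + mdist m p' q"
    using mdist_triangle[of p m q p'] in_m qm by (simp add: mdist_commute[of m q p'])
  ultimately show ?thesis using q(2) by linarith
qed

end

section \<open>Realization of consistent tuples\<close>

text \<open>A hierarchically hyperbolic space in which points have been chosen in the sets \<open>\<pi>\<^sub>W(x)\<close>, \<open>\<rho>\<close> and in
  the values of the maps \<open>\<rho>\<close>, here \<open>\<sigma> W V\<close>; a single \<open>E\<close> replaces all constants of the axioms.\<close>

locale coarse_hhs =
  fixes X :: "'x metric" and I :: "'i set" and M :: "'i \<Rightarrow> 'c metric"
    and pn orth :: "'i \<Rightarrow> 'i \<Rightarrow> bool"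
    and \<pi> :: "'i \<Rightarrow> 'x \<Rightarrow> 'c" and \<rho> :: "'i \<Rightarrow> 'i \<Rightarrow> 'c" and \<sigma> :: "'i \<Rightarrow> 'i \<Rightarrow> 'c \<Rightarrow> 'c"
    and E :: real and level :: "'i \<Rightarrow> nat" and n :: nat
    and tr :: "'i \<Rightarrow> 'i \<Rightarrow> bool"
  assumes tr_iff: "tr V W \<longleftrightarrow> V \<in> I \<and> W \<in> I \<and> V \<noteq> W \<and> \<not> pn V W \<and> \<not> pn W V \<and> \<not> orth V W"
    and E_ge_1: "1 \<le> E"
    and slim_space: "W \<in> I \<Longrightarrow> slim_space (M W) E"
    and proj_in [simp]: "W \<in> I \<Longrightarrow> x \<in> mspace X \<Longrightarrow> \<pi> W x \<in> mspace (M W)"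
    and proj_Lipschitz: "\<lbrakk>W \<in> I; x \<in> mspace X; y \<in> mspace X\<rbrakk>
      \<Longrightarrow> mdist (M W) (\<pi> W x) (\<pi> W y) \<le> E * mdist X x y + E"
    and proj_quasiconvex: "\<lbrakk>W \<in> I; x \<in> mspace X; y \<in> mspace X;
        geodesic_segment (M W) (\<pi> W x) (\<pi> W y) g; z \<in> g\<rbrakk>
      \<Longrightarrow> \<exists>u\<in>mspace X. mdist (M W) z (\<pi> W u) \<le> E"
    and pn_index: "pn V W \<Longrightarrow> V \<in> I \<and> W \<in> I"
    and pn_irrefl: "\<not> pn V V"
    and pn_trans: "pn U V \<Longrightarrow> pn V W \<Longrightarrow> pn U W"
    and orth_sym: "orth V W \<Longrightarrow> orth W V"
    and orth_irrefl: "\<not> orth V V"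
    and orth_not_pn: "orth V W \<Longrightarrow> \<not> pn V W"
    and orth_pn: "pn V W \<Longrightarrow> orth W U \<Longrightarrow> orth V U"
    and rho_in [simp]: "pn V W \<or> tr V W \<Longrightarrow> \<rho> V W \<in> mspace (M W)"
    and sigma_in [simp]: "pn V W \<Longrightarrow> p \<in> mspace (M W) \<Longrightarrow> \<sigma> W V p \<in> mspace (M V)"
    and transverse_consistency: "\<lbrakk>tr V W; x \<in> mspace X\<rbrakk>
      \<Longrightarrow> mdist (M W) (\<pi> W x) (\<rho> V W) \<le> E \<or> mdist (M V) (\<pi> V x) (\<rho> W V) \<le> E"
    and nested_consistency: "\<lbrakk>pn V W; x \<in> mspace X\<rbrakk>
      \<Longrightarrow> mdist (M W) (\<pi> W x) (\<rho> V W) \<le> E \<or> mdist (M V) (\<pi> V x) (\<sigma> W V (\<pi> W x)) \<le> E"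
    and rho_close: "\<lbrakk>pn U V; tr V W; tr U W\<rbrakk> \<Longrightarrow> mdist (M W) (\<rho> U W) (\<rho> V W) \<le> E"
    and finite_relevant: "\<lbrakk>x \<in> mspace X; y \<in> mspace X\<rbrakk>
      \<Longrightarrow> finite {W\<in>I. mdist (M W) (\<pi> W x) (\<pi> W y) > E}"
    and bounded_geodesic_image: "\<lbrakk>pn V W; geodesic_segment (M W) p q g;
        \<And>z. z \<in> g \<Longrightarrow> mdist (M W) z (\<rho> V W) > E; z \<in> g; z' \<in> g\<rbrakk>
      \<Longrightarrow> mdist (M V) (\<sigma> W V z) (\<sigma> W V z') \<le> E"
    and partial_realization: "\<lbrakk>F \<subseteq> I; \<And>V W. V \<in> F \<Longrightarrow> W \<in> F \<Longrightarrow> V \<noteq> W \<Longrightarrow> orth V W;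
        \<And>V. V \<in> F \<Longrightarrow> u V \<in> mspace X\<rbrakk>
      \<Longrightarrow> \<exists>x\<in>mspace X. \<forall>V\<in>F. mdist (M V) (\<pi> V x) (\<pi> V (u V)) \<le> E \<and>
            (\<forall>W. pn V W \<or> tr V W \<longrightarrow> mdist (M W) (\<pi> W x) (\<rho> V W) \<le> E)"
    and uniqueness: "\<exists>\<theta>. \<forall>x\<in>mspace X. \<forall>y\<in>mspace X.
        (\<forall>W\<in>I. mdist (M W) (\<pi> W x) (\<pi> W y) < \<kappa>) \<longrightarrow> mdist X x y \<le> \<theta>"
    and level_less: "pn V W \<Longrightarrow> level V < level W"
    and level_le: "W \<in> I \<Longrightarrow> level W \<le> n"
    and orth_family: "\<lbrakk>F \<subseteq> I; \<And>V W. V \<in> F \<Longrightarrow> W \<in> F \<Longrightarrow> V \<noteq> W \<Longrightarrow> orth V W\<rbrakk>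
      \<Longrightarrow> finite F \<and> card F \<le> n"
begin

lemma triangle:
  "\<lbrakk>p \<in> mspace (M W); q \<in> mspace (M W); r \<in> mspace (M W)\<rbrakk>
    \<Longrightarrow> mdist (M W) p r \<le> mdist (M W) p q + mdist (M W) q r"
  by (rule mdist_triangle)

lemma trI: "\<lbrakk>V \<in> I; W \<in> I; V \<noteq> W; \<not> pn V W; \<not> pn W V; \<not> orth V W\<rbrakk> \<Longrightarrow> tr V W"
  by (simp add: tr_iff)

lemma trD: "tr V W \<Longrightarrow> V \<in> I \<and> W \<in> I \<and> V \<noteq> W \<and> \<not> pn V W \<and> \<not> pn W V \<and> \<not> orth V W"
  by (simp add: tr_iff)

lemma tr_sym: "tr V W \<Longrightarrow> tr W V"
  using orth_sym by (auto simp: tr_iff)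

text \<open>The coordinates of a tuple are represented by points of the space: \<open>u\<close> stands for the tuple
  with coordinates \<open>\<pi> W (u W)\<close>.\<close>

definition dist_tuple :: "('i \<Rightarrow> 'x) \<Rightarrow> 'i \<Rightarrow> 'x \<Rightarrow> real" where
  "dist_tuple u W x = mdist (M W) (\<pi> W x) (\<pi> W (u W))"

definition consistent :: "real \<Rightarrow> ('i \<Rightarrow> 'x) \<Rightarrow> bool" where
  "consistent \<kappa> u \<longleftrightarrow> (\<forall>W\<in>I. u W \<in> mspace X) \<and>
     (\<forall>V W. tr V W \<longrightarrow> mdist (M W) (\<pi> W (u W)) (\<rho> V W) \<le> \<kappa> \<or> mdist (M V) (\<pi> V (u V)) (\<rho> W V) \<le> \<kappa>) \<and>
     (\<forall>V W. pn V W \<longrightarrow> mdist (M W) (\<pi> W (u W)) (\<rho> V W) \<le> \<kappa> \<or>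
        mdist (M V) (\<pi> V (u V)) (\<sigma> W V (\<pi> W (u W))) \<le> \<kappa>)"

text \<open>The invariant of the induction over families. A point realizing the tuple at
  \<open>T\<close> is near \<open>\<rho> T V\<close> in every \<open>V\<close> above or transverse
  to \<open>T\<close>; if the tuple is near \<open>\<rho> T V\<close> as well, these coordinates are
  correct automatically.\<close>

definition good :: "real \<Rightarrow> ('i \<Rightarrow> 'x) \<Rightarrow> 'i \<Rightarrow> bool" where
  "good \<theta> u T \<longleftrightarrow> (\<forall>V. pn T V \<or> tr T V \<longrightarrow> mdist (M V) (\<pi> V (u V)) (\<rho> T V) \<le> \<theta>)"

section \<open>The order on transverse domains relative to a consistent tuple\<close>

context
  fixes \<kappa> :: real and u :: "'i \<Rightarrow> 'x"
  assumes \<kappa>: "E \<le> \<kappa>" and cons: "consistent \<kappa> u"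
begin

lemma u_in [simp]: "W \<in> I \<Longrightarrow> u W \<in> mspace X"
  using cons by (simp add: consistent_def)

lemma tuple_transverse:
  assumes "tr V W" "\<kappa> < mdist (M W) (\<pi> W (u W)) (\<rho> V W)"
  shows "mdist (M V) (\<pi> V (u V)) (\<rho> W V) \<le> \<kappa>"
proof -
  have "mdist (M W) (\<pi> W (u W)) (\<rho> V W) \<le> \<kappa> \<or> mdist (M V) (\<pi> V (u V)) (\<rho> W V) \<le> \<kappa>"
    using cons assms(1) unfolding consistent_def by blast
  then show ?thesis using assms(2) by linarith
qed

lemma tuple_nested:
  assumes "pn V W" "\<kappa> < mdist (M W) (\<pi> W (u W)) (\<rho> V W)"
  shows "mdist (M V) (\<pi> V (u V)) (\<sigma> W V (\<pi> W (u W))) \<le> \<kappa>"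
proof -
  have "mdist (M W) (\<pi> W (u W)) (\<rho> V W) \<le> \<kappa> \<or> mdist (M V) (\<pi> V (u V)) (\<sigma> W V (\<pi> W (u W))) \<le> \<kappa>"
    using cons assms(1) unfolding consistent_def by blast
  then show ?thesis using assms(2) by linarith
qed

text \<open>\<open>before V W\<close>: moving away from the tuple, \<open>V\<close> is met before the transverse \<open>W\<close>.\<close>

definition before :: "'i \<Rightarrow> 'i \<Rightarrow> bool" where
  "before V W \<longleftrightarrow> tr V W \<and> 4 * \<kappa> < mdist (M V) (\<pi> V (u V)) (\<rho> W V)"

lemma before_close: "before V W \<Longrightarrow> mdist (M W) (\<pi> W (u W)) (\<rho> V W) \<le> \<kappa>"
  using tuple_transverse[of W V] tr_sym \<kappa> E_ge_1 unfolding before_def by auto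

lemma before_asym: "before V W \<Longrightarrow> \<not> before W V"
  using before_close[of V W] \<kappa> E_ge_1 unfolding before_def by auto

text \<open>Otherwise the tuple is within \<open>4 * \<kappa>\<close> of both \<open>\<rho>\<close>
  points. By consistency \<open>y\<close> is within \<open>E \<le> \<kappa>\<close> of one of them,
  so in that domain it is within \<open>5 * \<kappa>\<close> of the tuple.\<close>

lemma before_total:
  assumes y: "y \<in> mspace X" and VW: "tr V W"
    and bad: "5 * \<kappa> < dist_tuple u V y" "5 * \<kappa> < dist_tuple u W y"
  shows "before V W \<or> before W V"
proof (rule ccontr)
  assume "\<not> (before V W \<or> before W V)"
  then have far: "mdist (M V) (\<pi> V (u V)) (\<rho> W V) \<le> 4 * \<kappa>" "mdist (M W) (\<pi> W (u W)) (\<rho> V W) \<le> 4 * \<kappa>"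
    using VW tr_sym unfolding before_def by auto
  have in_m: "V \<in> I" "W \<in> I" "\<rho> W V \<in> mspace (M V)" "\<rho> V W \<in> mspace (M W)"
    using VW tr_sym trD by auto
  have "dist_tuple u V y \<le> mdist (M V) (\<pi> V y) (\<rho> W V) + mdist (M V) (\<pi> V (u V)) (\<rho> W V)"
    "dist_tuple u W y \<le> mdist (M W) (\<pi> W y) (\<rho> V W) + mdist (M W) (\<pi> W (u W)) (\<rho> V W)"
    unfolding dist_tuple_def using in_m y
    by (simp_all add: triangle mdist_commute[of _ "\<pi> _ (u _)"])
  then show False
    using transverse_consistency[OF VW y] far bad \<kappa> by linarith
qed

lemma realize:
  assumes "F \<subseteq> I" "\<And>V W. V \<in> F \<Longrightarrow> W \<in> F \<Longrightarrow> V \<noteq> W \<Longrightarrow> orth V W"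
  obtains x where "x \<in> mspace X" "\<And>V. V \<in> F \<Longrightarrow> dist_tuple u V x \<le> E"
    "\<And>V W. V \<in> F \<Longrightarrow> pn V W \<or> tr V W \<Longrightarrow> mdist (M W) (\<pi> W x) (\<rho> V W) \<le> E"
proof -
  have "u V \<in> mspace X" if "V \<in> F" for V using that assms(1) by auto
  then show ?thesis
    using partial_realization[of F u, OF assms] that unfolding dist_tuple_def by blast
qed

text \<open>In \<open>V2\<close> the tuple is near \<open>\<rho> V1 V2\<close> and far from
  \<open>\<rho> V3 V2\<close>, so a point \<open>z\<close> realizing \<open>V1\<close> is far from
  \<open>\<rho> V3 V2\<close>. Consistency then puts \<open>z\<close> near
  \<open>\<rho> V2 V3\<close>, which is near the tuple. But \<open>z\<close> is also near
  \<open>\<rho> V1 V3\<close>, which would be far from the tuple if \<open>V3\<close> came before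
  \<open>V1\<close>. The factor 4 beats the accumulated error
  \<open>\<kappa> + 2 * E\<close>.\<close>

lemma before_trans:
  assumes y: "y \<in> mspace X" and V12: "before V1 V2" and V23: "before V2 V3"
    and not_pn: "\<not> pn V1 V3" "\<not> pn V3 V1"
    and bad: "5 * \<kappa> < dist_tuple u V1 y" "5 * \<kappa> < dist_tuple u V3 y"
  shows "before V1 V3"
proof -
  have tr: "tr V1 V2" "tr V2 V3" "tr V2 V1" "tr V3 V2"
    using V12 V23 tr_sym unfolding before_def by auto
  have in_m: "V1 \<in> I" "V2 \<in> I" "V3 \<in> I" "\<rho> V1 V2 \<in> mspace (M V2)" "\<rho> V3 V2 \<in> mspace (M V2)"
    "\<rho> V2 V3 \<in> mspace (M V3)"
    using tr trD by auto
  have b1: "mdist (M V2) (\<pi> V2 (u V2)) (\<rho> V1 V2) \<le> \<kappa>" by (rule before_close[OF V12])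
  have b2: "mdist (M V2) (\<pi> V2 (u V2)) (\<rho> V3 V2) > 4 * \<kappa>" using V23 unfolding before_def by blast
  have b3: "mdist (M V3) (\<pi> V3 (u V3)) (\<rho> V2 V3) \<le> \<kappa>" by (rule before_close[OF V23])
  have z_far: "mdist (M V2) (\<pi> V2 z) (\<rho> V3 V2) > E"
    if z: "z \<in> mspace X" and z1: "mdist (M V2) (\<pi> V2 z) (\<rho> V1 V2) \<le> E" for z
  proof -
    have "mdist (M V2) (\<pi> V2 (u V2)) (\<rho> V3 V2)
        \<le> mdist (M V2) (\<pi> V2 (u V2)) (\<pi> V2 z) + mdist (M V2) (\<pi> V2 z) (\<rho> V3 V2)"
      "mdist (M V2) (\<pi> V2 (u V2)) (\<pi> V2 z)
        \<le> mdist (M V2) (\<pi> V2 (u V2)) (\<rho> V1 V2) + mdist (M V2) (\<pi> V2 z) (\<rho> V1 V2)"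
      using in_m z by (simp_all add: triangle mdist_commute[of _ "\<pi> _ z" "\<rho> V1 V2"])
    then show ?thesis using z1 b1 b2 \<kappa> E_ge_1 by linarith
  qed
  have "V1 \<noteq> V3" using before_asym V12 V23 by blast
  \<comment> \<open>Orthogonal domains could be realized by one point, which would be near both
    \<open>\<rho> V1 V2\<close> and \<open>\<rho> V3 V2\<close>, contrary to
    \<open>z_far\<close>.\<close>
  moreover have "\<not> orth V1 V3"
  proof
    assume o: "orth V1 V3"
    obtain z where "z \<in> mspace X"
      and z: "\<And>V W. V \<in> {V1, V3} \<Longrightarrow> pn V W \<or> tr V W \<Longrightarrow> mdist (M W) (\<pi> W z) (\<rho> V W) \<le> E"
      by (rule realize[of "{V1, V3}"]) (use in_m o orth_sym in auto)
    then show False using z_far[of z] z[of V1 V2] z[of V3 V2] tr by force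
  qed
  ultimately have tr13: "tr V1 V3" using in_m not_pn by (intro trI)
  show ?thesis
  proof (rule ccontr)
    assume "\<not> before V1 V3"
    then have "before V3 V1" using before_total[OF y tr13 bad] by blast
    then have b4: "4 * \<kappa> < mdist (M V3) (\<pi> V3 (u V3)) (\<rho> V1 V3)" by (simp add: before_def)
    obtain z where z: "z \<in> mspace X"
      "\<And>W. pn V1 W \<or> tr V1 W \<Longrightarrow> mdist (M W) (\<pi> W z) (\<rho> V1 W) \<le> E"
      by (rule realize[of "{V1}"]) (use in_m in auto)
    have "mdist (M V2) (\<pi> V2 z) (\<rho> V3 V2) > E" using z_far z tr(1) by blast
    then have z3: "mdist (M V3) (\<pi> V3 z) (\<rho> V2 V3) \<le> E"
      using transverse_consistency[OF tr(4) z(1)] by linarith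
    have z1: "mdist (M V3) (\<pi> V3 z) (\<rho> V1 V3) \<le> E" using z(2) tr13 by blast
    have "\<rho> V1 V3 \<in> mspace (M V3)" using tr13 by simp
    then have "mdist (M V3) (\<pi> V3 (u V3)) (\<rho> V1 V3)
        \<le> mdist (M V3) (\<pi> V3 (u V3)) (\<rho> V2 V3) + mdist (M V3) (\<rho> V2 V3) (\<rho> V1 V3)"
      "mdist (M V3) (\<rho> V2 V3) (\<rho> V1 V3) \<le> mdist (M V3) (\<pi> V3 z) (\<rho> V2 V3) + mdist (M V3) (\<pi> V3 z) (\<rho> V1 V3)"
      using in_m z(1) by (simp_all add: triangle mdist_commute[of _ "\<pi> _ z" "\<rho> V2 V3"])
    then show False using b4 b3 z1 z3 \<kappa> E_ge_1 by linarith
  qed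
qed

text \<open>Maximality of \<open>T\<close> under nesting controls the domains above
  \<open>T\<close>; minimality under \<open>before\<close> among the maximal bad domains controls
  the transverse ones.\<close>

lemma good_domain_exists:
  assumes y: "y \<in> mspace X" and R: "10 * \<kappa> \<le> R"
    and fin: "finite {W\<in>I. R < dist_tuple u W y}" and ne: "{W\<in>I. R < dist_tuple u W y} \<noteq> {}"
  obtains T where "T \<in> I" "R < dist_tuple u T y" "good (R + \<kappa>) u T"
proof -
  define B where "B = {W\<in>I. R < dist_tuple u W y}"
  define B' where "B' = {W\<in>B. \<forall>W'\<in>B. \<not> pn W W'}"
  have k0: "1 \<le> \<kappa>" using \<kappa> E_ge_1 by linarith
  have above: "\<exists>W'\<in>B'. V = W' \<or> pn V W'" if V: "V \<in> B" for V
  proof -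
    define C where "C = {W\<in>B. V = W \<or> pn V W}"
    have finC: "finite C" by (rule finite_subset[OF _ fin]) (auto simp: C_def B_def)
    have "\<exists>m\<in>C. \<forall>x\<in>C. x \<noteq> m \<longrightarrow> \<not> pn m x"
    proof (rule Finite_Set.bex_max_element)
      show "asymp_on C pn"
        by (rule asymp_onI) (use pn_trans pn_irrefl in metis)
      show "transp_on C pn" by (rule transp_onI) (erule (1) pn_trans)
    qed (use finC V in \<open>auto simp: C_def\<close>)
    then obtain m where m: "m \<in> C" "\<And>W. W \<in> C \<Longrightarrow> W \<noteq> m \<Longrightarrow> \<not> pn m W" by blast
    have "\<not> pn m W" if "W \<in> B" for W
    proof
      assume mW: "pn m W"
      then have "pn V W" using m(1) pn_trans[OF _ mW] unfolding C_def by blast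
      then show False using m(2)[of W] mW that pn_irrefl unfolding C_def by blast
    qed
    then show ?thesis using m(1) unfolding B'_def C_def by blast
  qed
  have B'_bad: "W \<in> I" "5 * \<kappa> < dist_tuple u W y" if "W \<in> B'" for W
    using that R k0 by (auto simp: B'_def B_def)
  have "\<exists>T\<in>B'. \<forall>V\<in>B'. V \<noteq> T \<longrightarrow> \<not> before V T"
  proof (rule Finite_Set.bex_min_element)
    show "finite B'" by (rule finite_subset[OF _ fin]) (auto simp: B'_def B_def)
    show "asymp_on B' before" using before_asym by (meson asymp_onI)
    show "transp_on B' before"
      using before_trans[OF y] B'_bad by (intro transp_onI) (auto simp: B'_def)
    show "B' \<noteq> {}" using above ne unfolding B_def by blast
  qed
  then obtain T where T: "T \<in> B'" "\<And>V. V \<in> B' \<Longrightarrow> \<not> before V T"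
    using before_def trD by metis
  have TI: "T \<in> I" and TR: "R < dist_tuple u T y" and Tmax: "\<And>V. V \<in> B \<Longrightarrow> \<not> pn T V"
    using T(1) by (auto simp: B'_def B_def)
  \<comment> \<open>By maximality \<open>y\<close> is within \<open>R\<close> of the tuple in
    \<open>V\<close>. A geodesic joining them would stay away from a \<open>\<rho> T V\<close>
    farther than \<open>R + \<kappa>\<close> from the tuple, and the bounded geodesic image property
    would make \<open>y\<close> almost correct at \<open>T\<close>.\<close>
  have "mdist (M V) (\<pi> V (u V)) (\<rho> T V) \<le> R + \<kappa>" if TV: "pn T V" for V
  proof (rule ccontr)
    assume "\<not> ?thesis"
    then have far: "R + \<kappa> < mdist (M V) (\<pi> V (u V)) (\<rho> T V)" by simp
    have VI: "V \<in> I" using TV pn_index by blast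
    have in_m: "\<pi> V y \<in> mspace (M V)" "\<pi> V (u V) \<in> mspace (M V)" "\<rho> T V \<in> mspace (M V)"
      using VI y TV by auto
    have yV: "dist_tuple u V y \<le> R" using Tmax[of V] VI TV unfolding B_def by force
    obtain g where g: "geodesic_segment (M V) (\<pi> V y) (\<pi> V (u V)) g"
      using slim_space.segment_exists[OF slim_space[OF VI] in_m(1,2)] .
    have zfar: "E < mdist (M V) z (\<rho> T V)" if "z \<in> g" for z
    proof -
      have "mdist (M V) z (\<pi> V (u V)) \<le> R"
        using geodesic_segment_dist[OF g that] yV mdist_nonneg[of "M V" "\<pi> V y" z]
        unfolding dist_tuple_def by linarith
      moreover have "mdist (M V) (\<pi> V (u V)) (\<rho> T V) \<le> mdist (M V) z (\<pi> V (u V)) + mdist (M V) z (\<rho> T V)"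
        using triangle[of "\<pi> V (u V)" V z "\<rho> T V"] in_m geodesic_segment_in[OF g that]
        by (simp add: mdist_commute[of _ "\<pi> V (u V)" z])
      ultimately show ?thesis using far \<kappa> by linarith
    qed
    have 1: "mdist (M T) (\<sigma> V T (\<pi> V y)) (\<sigma> V T (\<pi> V (u V))) \<le> E"
      using bounded_geodesic_image[OF TV g zfar] geodesic_segment_ends[OF g] by blast
    have 2: "mdist (M T) (\<pi> T y) (\<sigma> V T (\<pi> V y)) \<le> E"
      using nested_consistency[OF TV y] zfar geodesic_segment_ends(1)[OF g] by force
    have 3: "mdist (M T) (\<pi> T (u T)) (\<sigma> V T (\<pi> V (u V))) \<le> \<kappa>"
      using tuple_nested[OF TV] far R k0 by simp
    have "dist_tuple u T y \<le> mdist (M T) (\<pi> T y) (\<sigma> V T (\<pi> V y)) + mdist (M T) (\<sigma> V T (\<pi> V y)) (\<pi> T (u T))"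
      "mdist (M T) (\<sigma> V T (\<pi> V y)) (\<pi> T (u T)) \<le> mdist (M T) (\<sigma> V T (\<pi> V y)) (\<sigma> V T (\<pi> V (u V)))
        + mdist (M T) (\<pi> T (u T)) (\<sigma> V T (\<pi> V (u V)))"
      unfolding dist_tuple_def using TI TV in_m y
      by (simp_all add: triangle mdist_commute[of _ "\<pi> T (u T)"])
    then show False using 1 2 3 TR R \<kappa> k0 by linarith
  qed
  \<comment> \<open>If \<open>\<rho> T V\<close> were far, consistency of the tuple and of
    \<open>y\<close> would make \<open>V\<close> bad. A maximal bad \<open>V'\<close> equal to or
    above \<open>V\<close> is still transverse to \<open>T\<close>, and \<open>\<rho> V' T\<close>
    is close to \<open>\<rho> V T\<close>. So \<open>T\<close> is not before \<open>V'\<close>,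
    hence \<open>V'\<close> is before \<open>T\<close>, against minimality.\<close>
  moreover have "mdist (M V) (\<pi> V (u V)) (\<rho> T V) \<le> R + \<kappa>" if TV: "tr T V" for V
  proof (rule ccontr)
    assume "\<not> ?thesis"
    then have far: "R + \<kappa> < mdist (M V) (\<pi> V (u V)) (\<rho> T V)" by simp
    have VT: "tr V T" using TV tr_sym by blast
    have in_m: "V \<in> I" "\<rho> T V \<in> mspace (M V)" "\<rho> V T \<in> mspace (M T)"
      using TV VT trD by auto
    have bT: "mdist (M T) (\<pi> T (u T)) (\<rho> V T) \<le> \<kappa>" using tuple_transverse[OF TV] far R k0 by simp
    have "dist_tuple u T y \<le> mdist (M T) (\<pi> T y) (\<rho> V T) + mdist (M T) (\<pi> T (u T)) (\<rho> V T)"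
      unfolding dist_tuple_def using TI in_m y by (simp add: triangle mdist_commute[of _ "\<pi> T (u T)"])
    then have yV: "mdist (M V) (\<pi> V y) (\<rho> T V) \<le> E"
      using transverse_consistency[OF TV y] bT TR R \<kappa> k0 by linarith
    have "mdist (M V) (\<pi> V (u V)) (\<rho> T V) \<le> dist_tuple u V y + mdist (M V) (\<pi> V y) (\<rho> T V)"
      unfolding dist_tuple_def using in_m y by (simp add: triangle mdist_commute[of _ "\<pi> V y" "\<pi> V (u V)"])
    then have "V \<in> B" using yV far \<kappa> in_m by (simp add: B_def)
    then obtain V' where V': "V' \<in> B'" "V = V' \<or> pn V V'" using above by blast
    have V'I: "V' \<in> I" using V' B'_bad by blast
    have trV': "tr V' T"
    proof (cases "V = V'")
      case False
      then have VV': "pn V V'" using V' by blast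
      show ?thesis
      proof (intro trI V'I TI)
        show "V' \<noteq> T" using VV' TV trD by blast
        show "\<not> pn V' T" "\<not> pn T V'" using V'(1) T(1) by (auto simp: B'_def)
        show "\<not> orth V' T" using orth_pn[OF VV'] VT trD by blast
      qed
    qed (use VT in simp)
    have "mdist (M T) (\<rho> V T) (\<rho> V' T) \<le> E"
      using rho_close[OF _ trV' VT] V'(2) E_ge_1 mdist_self[OF in_m(3)] by auto
    moreover have "mdist (M T) (\<pi> T (u T)) (\<rho> V' T) \<le> mdist (M T) (\<pi> T (u T)) (\<rho> V T) + mdist (M T) (\<rho> V T) (\<rho> V' T)"
      using TI in_m trV' by (simp add: triangle)
    ultimately have "\<not> before T V'" using bT \<kappa> k0 by (simp add: before_def)
    then have "before V' T"
      using before_total[OF y trV'] B'_bad V'(1) T(1) by blast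
    then show False using T(2) V'(1) by blast
  qed
  ultimately have "good (R + \<kappa>) u T" unfolding good_def by blast
  then show ?thesis using that TI TR by blast
qed

text \<open>A lexicographic order packed into one number: larger families count as simpler, and
  among families of equal size those of smaller total level. The weight \<open>n * n + 1\<close>
  exceeds every level sum of an orthogonal family, which has at most \<open>n\<close> members of
  level at most \<open>n\<close>.\<close>

definition complexity :: "'i set \<Rightarrow> nat" where
  "complexity F = (n + 1 - card F) * (n * n + 1) + sum level F"

text \<open>A point realizing the tuple on an orthogonal family \<open>F\<close> of good domains is wrong only at
  domains nested in a member of \<open>F\<close> or orthogonal to all of \<open>F\<close>, so a good domain among those gives
  a refined or a larger family.\<close>

lemma realize_from_family:
  assumes fin: "\<And>y. y \<in> mspace X \<Longrightarrow> finite {W\<in>I. R\<^sub>0 < dist_tuple u W y}" and R0: "10 * \<kappa> \<le> R\<^sub>0"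
    and "F \<subseteq> I" "\<And>V W. V \<in> F \<Longrightarrow> W \<in> F \<Longrightarrow> V \<noteq> W \<Longrightarrow> orth V W"
    and "\<And>V. V \<in> F \<Longrightarrow> good \<theta> u V" and "0 \<le> \<theta>"
  shows "\<exists>y\<in>mspace X. \<forall>W\<in>I. dist_tuple u W y \<le> \<theta> + (real (complexity F) + 1) * (E + \<kappa> + R\<^sub>0)"
  using assms(3-)
proof (induction "complexity F" arbitrary: F \<theta> rule: less_induct)
  case less
  define c where "c = E + \<kappa> + R\<^sub>0"
  have c0: "0 \<le> c" using \<kappa> E_ge_1 R0 by (simp add: c_def)
  \<comment> \<open>\<open>\<theta> + E\<close> is the error of \<open>y\<close> at domains above or
    transverse to the family: \<open>E\<close> to the \<open>\<rho>\<close> point and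
    \<open>\<theta>\<close> from there to the tuple. The summand \<open>R\<^sub>0\<close> makes the
    set of bad domains finite. A domain found at threshold \<open>R\<close> is good for
    \<open>R + \<kappa> = \<theta> + c\<close>.\<close>
  define R where "R = \<theta> + E + R\<^sub>0"
  have R: "10 * \<kappa> \<le> R" "R\<^sub>0 \<le> R" "R + \<kappa> = \<theta> + c" "E \<le> R"
    using R0 less.prems(4) E_ge_1 \<kappa> by (auto simp: R_def c_def)
  obtain y where y: "y \<in> mspace X" "\<And>V. V \<in> F \<Longrightarrow> dist_tuple u V y \<le> E"
    "\<And>V W. V \<in> F \<Longrightarrow> pn V W \<or> tr V W \<Longrightarrow> mdist (M W) (\<pi> W y) (\<rho> V W) \<le> E"
    by (rule realize[of F]) (use less.prems in auto)
  show ?case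
  proof (cases "{W\<in>I. R < dist_tuple u W y} = {}")
    case True
    have "dist_tuple u W y \<le> \<theta> + (real (complexity F) + 1) * (E + \<kappa> + R\<^sub>0)" if "W \<in> I" for W
    proof -
      have "0 \<le> real (complexity F) * c" using c0 by simp
      moreover have "dist_tuple u W y \<le> R" using True that by force
      ultimately show ?thesis using R \<kappa> E_ge_1 by (simp add: c_def algebra_simps)
    qed
    then show ?thesis using y(1) by blast
  next
    case False
    have "finite {W\<in>I. R < dist_tuple u W y}"
      by (rule finite_subset[OF _ fin[OF y(1)]]) (use R in auto)
    then obtain T where T: "T \<in> I" "R < dist_tuple u T y" "good (R + \<kappa>) u T"
      by (rule good_domain_exists[OF y(1) R(1) _ False])
    have rel: "pn T U \<or> orth T U" if U: "U \<in> F" for U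
    proof -
      have "\<not> (pn U T \<or> tr U T)"
      proof
        assume *: "pn U T \<or> tr U T"
        have "mdist (M T) (\<pi> T (u T)) (\<rho> U T) \<le> \<theta>"
          using less.prems(3)[OF U] * unfolding good_def by blast
        moreover have "dist_tuple u T y \<le> mdist (M T) (\<pi> T y) (\<rho> U T) + mdist (M T) (\<pi> T (u T)) (\<rho> U T)"
          unfolding dist_tuple_def using T(1) y(1) *
          by (simp add: triangle mdist_commute[of _ "\<pi> T (u T)"])
        ultimately show False using y(3)[OF U *] T(2) R0 \<kappa> E_ge_1 by (simp add: R_def)
      qed
      moreover have "T \<noteq> U" using y(2)[OF U] T(2) R(4) by auto
      ultimately show ?thesis using trI[of T U] T(1) U less.prems(1) tr_sym by blast
    qed
    define F' where "F' = insert T {U\<in>F. orth T U}"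
    have finF: "finite F" "card F \<le> n" using orth_family[of F] less.prems by auto
    have F'I: "F' \<subseteq> I" using T(1) less.prems(1) by (auto simp: F'_def)
    have F'o: "orth V W" if "V \<in> F'" "W \<in> F'" "V \<noteq> W" for V W
      using that less.prems(2) orth_sym by (auto simp: F'_def)
    have F'g: "good (\<theta> + c) u V" if V: "V \<in> F'" for V
    proof (cases "V = T")
      case False
      then have "good \<theta> u V" using V less.prems(3) by (auto simp: F'_def)
      then show ?thesis unfolding good_def using c0 by fastforce
    qed (use T(3) R(3) in simp)
    have "complexity F' < complexity F"
    \<comment> \<open>If \<open>T\<close> is nested in a member \<open>U\<close>, it inherits
      orthogonality to all other members and replaces \<open>U\<close>: same size, smaller level
      sum. Otherwise it is orthogonal to the whole family and is added.\<close>
    proof (cases "\<exists>U\<in>F. pn T U")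
      case True
      then obtain U where U: "U \<in> F" "pn T U" by blast
      have "orth T V" if "V \<in> F - {U}" for V
        using orth_pn[OF U(2)] less.prems(2)[OF U(1)] that by blast
      moreover have "\<not> orth T U" using orth_not_pn U(2) by blast
      ultimately have F': "F' = insert T (F - {U})" unfolding F'_def by blast
      have "T \<notin> F - {U}" using \<open>\<And>V. V \<in> F - {U} \<Longrightarrow> orth T V\<close> orth_irrefl by blast
      then have "card F' = Suc (card (F - {U}))" "sum level F' = level T + sum level (F - {U})"
        using finF by (simp_all add: F')
      moreover have "Suc (card (F - {U})) = card F" using finF U(1) by (rule_tac card_Suc_Diff1) auto
      moreover have "sum level F = level U + sum level (F - {U})"
        using finF U(1) by (simp add: sum.remove)
      ultimately show ?thesis using level_less[OF U(2)] by (simp add: complexity_def)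
    next
      case nopn: False
      then have F': "F' = insert T F" and TF: "T \<notin> F" using rel orth_irrefl unfolding F'_def by blast+
      have card: "card F' = Suc (card F)" using TF finF by (simp add: F')
      have F'n: "card F' \<le> n" using orth_family[OF F'I F'o] by blast
      have "sum level F' \<le> card F' * n" using level_le F'I sum_bounded_above[of F' level n] by auto
      also have "\<dots> \<le> n * n" using F'n by simp
      finally have "sum level F' < n * n + 1" by simp
      moreover have "(n + 1 - card F) = Suc (n + 1 - card F')" using card F'n by simp
      ultimately show ?thesis by (simp add: complexity_def)
    qed
    moreover from this obtain y' where y': "y' \<in> mspace X"
      "\<And>W. W \<in> I \<Longrightarrow> dist_tuple u W y' \<le> \<theta> + c + (real (complexity F') + 1) * (E + \<kappa> + R\<^sub>0)"
      using less.hyps[OF _ F'I F'o F'g] less.prems(4) c0 by auto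
    \<comment> \<open>The strict decrease of the measure frees one summand \<open>c\<close>, which
      pays for the growth of \<open>\<theta>\<close>.\<close>
    ultimately have "(real (complexity F') + 1) * c \<le> real (complexity F) * c"
      using c0 by (intro mult_right_mono) auto
    then have "\<theta> + c + (real (complexity F') + 1) * (E + \<kappa> + R\<^sub>0)
        \<le> \<theta> + (real (complexity F) + 1) * (E + \<kappa> + R\<^sub>0)"
      by (simp add: c_def algebra_simps)
    then show ?thesis using y' by (meson order_trans)
  qed
qed

end

text \<open>The induction starts with the empty family, which is good for
  \<open>\<theta> = 0\<close> and has measure \<open>(n + 1) * (n * n + 1)\<close>. The tuple does
  not enter.\<close>

definition realization_constant :: "real \<Rightarrow> real \<Rightarrow> real" where
  "realization_constant \<kappa> R\<^sub>0 = (real ((n + 1) * (n * n + 1)) + 1) * (E + \<kappa> + R\<^sub>0)"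

lemma realization:
  assumes "E \<le> \<kappa>" "consistent \<kappa> u" "10 * \<kappa> \<le> R\<^sub>0"
    and "\<And>y. y \<in> mspace X \<Longrightarrow> finite {W\<in>I. R\<^sub>0 < dist_tuple u W y}"
  shows "\<exists>y\<in>mspace X. \<forall>W\<in>I. dist_tuple u W y \<le> realization_constant \<kappa> R\<^sub>0"
  using realize_from_family[OF assms(1,2,4,3), of "{}" 0]
  by (simp add: realization_constant_def complexity_def[OF assms(1,2)])

end

section \<open>Gates\<close>

context coarse_hhs
begin

text \<open>Spanned by the chosen points only, whereas \<open>H_theta\<close> uses the full sets
  \<open>proj_set\<close>. The former hull is contained in the latter, which in turn lies within
  \<open>3 * E\<close> of it by \<open>hull_close\<close>.\<close>

definition coord_hull :: "'x set \<Rightarrow> 'i \<Rightarrow> 'c set" where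
  "coord_hull A W = geodesic_hull (M W) (\<pi> W ` A)"

lemma coord_hull_in: "z \<in> coord_hull A W \<Longrightarrow> z \<in> mspace (M W)"
  unfolding coord_hull_def by (rule geodesic_hull_in)

lemma proj_in_hull: "A \<subseteq> mspace X \<Longrightarrow> W \<in> I \<Longrightarrow> a \<in> A \<Longrightarrow> \<pi> W a \<in> coord_hull A W"
  unfolding coord_hull_def using subset_geodesic_hull[of "\<pi> W ` A" "M W"] proj_in by blast

lemma coord_hull_bounded:
  assumes "A \<subseteq> mspace X" "W \<in> I" "c \<in> mspace (M W)" "\<And>a. a \<in> A \<Longrightarrow> mdist (M W) (\<pi> W a) c \<le> r"
    "z \<in> coord_hull A W"
  shows "mdist (M W) z c \<le> 3 * r"
  using assms geodesic_hull_bounded[of "\<pi> W ` A" "M W" c r z] unfolding coord_hull_def by force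

section \<open>Consistency of the tuple of projections to the hulls\<close>

context
  fixes A :: "'x set" and x :: 'x and \<beta> :: "'i \<Rightarrow> 'c" and u :: "'i \<Rightarrow> 'x"
  assumes A: "A \<subseteq> mspace X" "A \<noteq> {}" and x: "x \<in> mspace X"
    and \<beta>: "\<And>W. W \<in> I \<Longrightarrow> near_projection (M W) (coord_hull A W) (\<pi> W x) (\<beta> W)"
    and u: "\<And>W. W \<in> I \<Longrightarrow> u W \<in> mspace X" "\<And>W. W \<in> I \<Longrightarrow> mdist (M W) (\<beta> W) (\<pi> W (u W)) \<le> E"
begin

lemma beta_hull: "W \<in> I \<Longrightarrow> \<beta> W \<in> coord_hull A W"
  using \<beta> by (auto simp: near_projection_def)

lemma beta_in [simp]: "W \<in> I \<Longrightarrow> \<beta> W \<in> mspace (M W)"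
  using beta_hull coord_hull_in by blast

lemma beta_nearest: "W \<in> I \<Longrightarrow> y \<in> coord_hull A W \<Longrightarrow> mdist (M W) (\<pi> W x) (\<beta> W) \<le> mdist (M W) (\<pi> W x) y + 1"
  using \<beta> by (auto simp: near_projection_def)

lemma A_in [simp]: "a \<in> A \<Longrightarrow> a \<in> mspace X"
  using A by blast

lemma u_mspace [simp]: "W \<in> I \<Longrightarrow> u W \<in> mspace X"
  using u by blast

lemma dist_u_le:
  assumes "W \<in> I" "p \<in> mspace (M W)"
  shows "mdist (M W) (\<pi> W (u W)) p \<le> E + mdist (M W) (\<beta> W) p"
  using triangle[of "\<pi> W (u W)" W "\<beta> W" p] u(2)[OF assms(1)] assms
  by (simp add: mdist_commute[of _ _ "\<beta> W"])

text \<open>\<open>\<beta> W\<close> is at most 1 farther from \<open>x\<close> than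
  \<open>a\<close> is. Hence if \<open>x\<close> and a single point of \<open>A\<close> are near
  \<open>p\<close>, so is the projection.\<close>

lemma gate_close_of_proj_close:
  assumes W: "W \<in> I" and p: "p \<in> mspace (M W)" and a: "a \<in> A"
    and "mdist (M W) (\<pi> W x) p \<le> r" "mdist (M W) (\<pi> W a) p \<le> s"
  shows "mdist (M W) (\<pi> W (u W)) p \<le> E + 2 * r + s + 1"
proof -
  have "mdist (M W) (\<pi> W x) (\<beta> W) \<le> mdist (M W) (\<pi> W x) (\<pi> W a) + 1"
    using beta_nearest[OF W] proj_in_hull[OF A(1) W a] .
  moreover have "mdist (M W) (\<pi> W x) (\<pi> W a) \<le> mdist (M W) (\<pi> W x) p + mdist (M W) (\<pi> W a) p"
    "mdist (M W) (\<beta> W) p \<le> mdist (M W) (\<pi> W x) (\<beta> W) + mdist (M W) (\<pi> W x) p"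
    using triangle[of "\<pi> W x" W p "\<pi> W a"] triangle[of "\<beta> W" W "\<pi> W x" p] W x a p
    by (simp_all add: mdist_commute[of _ p "\<pi> W a"] mdist_commute[of _ "\<beta> W" "\<pi> W x"])
  ultimately show ?thesis using dist_u_le[OF W p] assms(4,5) by linarith
qed

text \<open>If all of \<open>A\<close> is near \<open>p\<close>, so is the hull, wherever
  \<open>x\<close> lies.\<close>

lemma gate_close_of_hull_close:
  assumes W: "W \<in> I" and p: "p \<in> mspace (M W)" and "\<And>a. a \<in> A \<Longrightarrow> mdist (M W) (\<pi> W a) p \<le> r"
  shows "mdist (M W) (\<pi> W (u W)) p \<le> E + 3 * r"
  using coord_hull_bounded[OF A(1) W p assms(3) beta_hull[OF W]] dist_u_le[OF W p] by linarith

text \<open>By consistency of its points, either all of \<open>A\<close> is near the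
  \<open>\<rho>\<close> point in one of the two domains, or each domain has a point of
  \<open>A\<close> near its \<open>\<rho>\<close> point. In the last case \<open>x\<close> is near
  one of these \<open>\<rho>\<close> points too and decides.\<close>

lemma gate_transverse_consistent:
  assumes VW: "tr V W"
  shows "mdist (M W) (\<pi> W (u W)) (\<rho> V W) \<le> 10 * E \<or> mdist (M V) (\<pi> V (u V)) (\<rho> W V) \<le> 10 * E"
proof -
  have I: "V \<in> I" "W \<in> I" "\<rho> V W \<in> mspace (M W)" "\<rho> W V \<in> mspace (M V)"
    using VW tr_sym trD by auto
  consider "\<forall>a\<in>A. mdist (M W) (\<pi> W a) (\<rho> V W) \<le> E" | "\<forall>a\<in>A. mdist (M V) (\<pi> V a) (\<rho> W V) \<le> E"
    | a a' where "a \<in> A" "mdist (M W) (\<pi> W a) (\<rho> V W) \<le> E" "a' \<in> A" "mdist (M V) (\<pi> V a') (\<rho> W V) \<le> E"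
    using transverse_consistency[OF VW] A_in by meson
  then show ?thesis
  proof cases
    case 1
    then show ?thesis using gate_close_of_hull_close[OF I(2,3), of E] E_ge_1 by fastforce
  next
    case 2
    then show ?thesis using gate_close_of_hull_close[OF I(1,4), of E] E_ge_1 by fastforce
  next
    case 3
    then show ?thesis
      using transverse_consistency[OF VW x] E_ge_1
        gate_close_of_proj_close[OF I(2,3) 3(1) _ 3(2), of E]
        gate_close_of_proj_close[OF I(1,4) 3(3) _ 3(4), of E] by linarith
  qed
qed

text \<open>Nested consistency compares \<open>y\<close> with \<open>\<sigma>\<close> of its own
  coordinate; the bounded geodesic image property carries this along \<open>g\<close> to
  \<open>\<beta> W\<close>.\<close>

lemma sigma_beta_close:
  assumes VW: "pn V W" and y: "y \<in> mspace X" and g: "geodesic_segment (M W) (\<pi> W y) (\<beta> W) g"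
    and far: "\<And>z. z \<in> g \<Longrightarrow> E < mdist (M W) z (\<rho> V W)"
  shows "mdist (M V) (\<pi> V y) (\<sigma> W V (\<beta> W)) \<le> 2 * E"
proof -
  have I: "V \<in> I" "W \<in> I" using VW pn_index by blast+
  note ends = geodesic_segment_ends[OF g]
  have "mdist (M V) (\<pi> V y) (\<sigma> W V (\<pi> W y)) \<le> E"
    using nested_consistency[OF VW y] far[OF ends(1)] by linarith
  moreover have "mdist (M V) (\<sigma> W V (\<pi> W y)) (\<sigma> W V (\<beta> W)) \<le> E"
    using bounded_geodesic_image[OF VW g far ends] .
  moreover have "mdist (M V) (\<pi> V y) (\<sigma> W V (\<beta> W))
      \<le> mdist (M V) (\<pi> V y) (\<sigma> W V (\<pi> W y)) + mdist (M V) (\<sigma> W V (\<pi> W y)) (\<sigma> W V (\<beta> W))"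
    using I y VW by (simp add: triangle)
  ultimately show ?thesis by linarith
qed

text \<open>With \<open>\<rho> V W\<close> far from \<open>\<beta> W\<close>, the point
  \<open>\<sigma> W V (\<beta> W)\<close> serves as reference in \<open>V\<close>. It suffices that
  all of \<open>A\<close>, or \<open>x\<close> together with one point of \<open>A\<close>, be near
  it there; which of the two holds depends on whether the geodesic from \<open>x\<close> to
  \<open>\<beta> W\<close> passes near \<open>\<rho> V W\<close>.\<close>

lemma gate_nested_consistent:
  assumes VW: "pn V W"
  shows "mdist (M W) (\<pi> W (u W)) (\<rho> V W) \<le> 10 * E \<or>
    mdist (M V) (\<pi> V (u V)) (\<sigma> W V (\<pi> W (u W))) \<le> 10 * E"
proof (cases "10 * E < mdist (M W) (\<pi> W (u W)) (\<rho> V W)")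
  case far: True
  have I: "V \<in> I" "W \<in> I" using VW pn_index by blast+
  have in_m: "\<rho> V W \<in> mspace (M W)" "\<sigma> W V (\<beta> W) \<in> mspace (M V)" using VW I by auto
  interpret W: slim_space "M W" E by (rule slim_space[OF I(2)])
  have far\<beta>: "9 * E < mdist (M W) (\<beta> W) (\<rho> V W)" using far dist_u_le[OF I(2) in_m(1)] by linarith
  have near: "9 * E < mdist (M W) z (\<beta> W) + mdist (M W) z (\<rho> V W)" if "z \<in> mspace (M W)" for z
    using triangle[of "\<beta> W" W z "\<rho> V W"] that in_m I far\<beta> by (simp add: mdist_commute[of _ z "\<beta> W"])
  have \<sigma>u: "mdist (M V) (\<sigma> W V (\<beta> W)) (\<sigma> W V (\<pi> W (u W))) \<le> E"
  proof -
    obtain g where g: "geodesic_segment (M W) (\<beta> W) (\<pi> W (u W)) g"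
      using W.segment_exists[of "\<beta> W" "\<pi> W (u W)"] I by auto
    have "E < mdist (M W) z (\<rho> V W)" if "z \<in> g" for z
      using near[OF geodesic_segment_in[OF g that]] geodesic_segment_dist[OF g that] u(2)[OF I(2)] E_ge_1
        mdist_nonneg[of "M W" z "\<pi> W (u W)"] mdist_commute[of "M W" z "\<beta> W"] by linarith
    then show ?thesis using bounded_geodesic_image[OF VW g _ geodesic_segment_ends[OF g]] by blast
  qed
  have "mdist (M V) (\<pi> V (u V)) (\<sigma> W V (\<beta> W)) \<le> 9 * E"
  proof -
    obtain h where h: "geodesic_segment (M W) (\<pi> W x) (\<beta> W) h"
      using W.segment_exists[of "\<pi> W x" "\<beta> W"] I x by auto
    show ?thesis
    \<comment> \<open>If the geodesic from \<open>x\<close> passes near \<open>\<rho> V W\<close>,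
      none from a point of \<open>A\<close> to \<open>\<beta> W\<close> can: by quasiconvexity the
      hull would have a point near \<open>\<rho> V W\<close>, much closer to \<open>x\<close> than
      \<open>\<beta> W\<close> is.\<close>
    proof (cases "\<exists>z\<in>h. mdist (M W) z (\<rho> V W) \<le> E")
      case True
      then obtain z where z: "z \<in> h" "mdist (M W) z (\<rho> V W) \<le> E" by blast
      have zm: "z \<in> mspace (M W)" using geodesic_segment_in[OF h z(1)] .
      have z\<beta>: "8 * E < mdist (M W) z (\<beta> W)" using near[OF zm] z(2) by linarith
      have "mdist (M V) (\<pi> V a) (\<sigma> W V (\<beta> W)) \<le> 2 * E" if a: "a \<in> A" for a
      proof -
        obtain g where g: "geodesic_segment (M W) (\<pi> W a) (\<beta> W) g"
          using W.segment_exists[of "\<pi> W a" "\<beta> W"] I a by auto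
        have "E < mdist (M W) w (\<rho> V W)" if w: "w \<in> g" for w
        proof (rule ccontr)
          assume "\<not> E < mdist (M W) w (\<rho> V W)"
          then have w\<rho>: "mdist (M W) w (\<rho> V W) \<le> E" by simp
          have wm: "w \<in> mspace (M W)" using geodesic_segment_in[OF g w] .
          have "\<pi> W ` A \<subseteq> mspace (M W)" using I by auto
          then obtain v where v: "v \<in> coord_hull A W" "mdist (M W) w v \<le> 2 * E"
            using W.hull_quasiconvex[OF _ _ _ g w] proj_in_hull[OF A(1) I(2) a] beta_hull[OF I(2)]
            unfolding coord_hull_def by metis
          have "mdist (M W) (\<pi> W x) v \<le> mdist (M W) (\<pi> W x) z + mdist (M W) z v"
            "mdist (M W) z v \<le> mdist (M W) z w + mdist (M W) w v"
            "mdist (M W) z w \<le> mdist (M W) z (\<rho> V W) + mdist (M W) w (\<rho> V W)"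
            using zm wm coord_hull_in[OF v(1)] I x in_m by (simp_all add: triangle mdist_commute[of _ w "\<rho> V W"])
          then show False
            using beta_nearest[OF I(2) v(1)] geodesic_segment_dist[OF h z(1)] z\<beta> z(2) w\<rho> v(2) E_ge_1
            by linarith
        qed
        then show ?thesis using sigma_beta_close[OF VW _ g] a by simp
      qed
      then have "mdist (M V) (\<pi> V (u V)) (\<sigma> W V (\<beta> W)) \<le> E + 3 * (2 * E)"
        by (rule gate_close_of_hull_close[OF I(1) in_m(2)])
      then show ?thesis using E_ge_1 by linarith
    next
      case False
      then have x\<sigma>: "mdist (M V) (\<pi> V x) (\<sigma> W V (\<beta> W)) \<le> 2 * E"
        by (intro sigma_beta_close[OF VW x h]) auto
      obtain p q k where k: "p \<in> \<pi> W ` A" "q \<in> \<pi> W ` A" "geodesic_segment (M W) p q k" "\<beta> W \<in> k"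
        using beta_hull[OF I(2)] unfolding coord_hull_def by (rule geodesic_hullE)
      obtain k1 k2 where k12: "geodesic_segment (M W) p (\<beta> W) k1" "geodesic_segment (M W) (\<beta> W) q k2"
        and split: "\<And>s t. s \<in> k1 \<Longrightarrow> t \<in> k2 \<Longrightarrow>
            mdist (M W) s t = mdist (M W) s (\<beta> W) + mdist (M W) (\<beta> W) t"
        using geodesic_segment_split[OF k(3,4)] by metis
      \<comment> \<open>\<open>\<beta> W\<close> separates a geodesic between two points of
        \<open>A\<close> into halves. If both came near \<open>\<rho> V W\<close>, two points at
        distance at most \<open>2 * E\<close> would have the distant \<open>\<beta> W\<close>
        between them. The end of the other half is the required point of \<open>A\<close>.\<close>
      have "(\<forall>s\<in>k1. E < mdist (M W) s (\<rho> V W)) \<or> (\<forall>t\<in>k2. E < mdist (M W) t (\<rho> V W))"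
      proof (rule ccontr)
        assume "\<not> ?thesis"
        then obtain s t where st: "s \<in> k1" "t \<in> k2" "mdist (M W) s (\<rho> V W) \<le> E" "mdist (M W) t (\<rho> V W) \<le> E"
          by force
        have sm: "s \<in> mspace (M W)" "t \<in> mspace (M W)"
          using st(1,2) k12 by (auto dest: geodesic_segment_in)
        have "mdist (M W) s t \<le> mdist (M W) s (\<rho> V W) + mdist (M W) t (\<rho> V W)"
          using sm in_m by (simp add: triangle mdist_commute[of _ t "\<rho> V W"])
        then show False
          using split[OF st(1,2)] near[OF sm(1)] st(3,4) E_ge_1 mdist_nonneg[of "M W" "\<beta> W" t] by linarith
      qed
      then obtain a where a: "a \<in> A" "mdist (M V) (\<pi> V a) (\<sigma> W V (\<beta> W)) \<le> 2 * E"
      proof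
        assume *: "\<forall>s\<in>k1. E < mdist (M W) s (\<rho> V W)"
        obtain a where a: "a \<in> A" "p = \<pi> W a" using k(1) by blast
        show thesis using that[OF a(1)] sigma_beta_close[OF VW A_in[OF a(1)]] k12(1) * a(2) by blast
      next
        assume *: "\<forall>s\<in>k2. E < mdist (M W) s (\<rho> V W)"
        obtain a where a: "a \<in> A" "q = \<pi> W a" using k(2) by blast
        show thesis
          using that[OF a(1)] sigma_beta_close[OF VW A_in[OF a(1)]] geodesic_segment_sym[OF k12(2)] * a(2)
          by blast
      qed
      show ?thesis using gate_close_of_proj_close[OF I(1) in_m(2) a(1) x\<sigma> a(2)] E_ge_1 by linarith
    qed
  qed
  moreover have "mdist (M V) (\<pi> V (u V)) (\<sigma> W V (\<pi> W (u W))) \<le> mdist (M V) (\<pi> V (u V)) (\<sigma> W V (\<beta> W))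
      + mdist (M V) (\<sigma> W V (\<beta> W)) (\<sigma> W V (\<pi> W (u W)))"
    using I in_m VW by (simp add: triangle)
  ultimately show ?thesis using \<sigma>u by linarith
qed simp

lemma gate_consistent: "consistent (10 * E) u"
  unfolding consistent_def using gate_transverse_consistent gate_nested_consistent u by blast

text \<open>The \<open>W\<close>-distance from \<open>y\<close> to the gate is large only if the \<open>W\<close>-distance of \<open>x\<close> to \<open>y\<close> or to
  a fixed point of \<open>A\<close> is.\<close>

lemma gate_finite:
  assumes y: "y \<in> mspace X"
  shows "finite {W\<in>I. 100 * E < dist_tuple u W y}"
proof -
  obtain a where a: "a \<in> A" using A by blast
  have "{W\<in>I. 100 * E < dist_tuple u W y} \<subseteq>
      {W\<in>I. mdist (M W) (\<pi> W x) (\<pi> W y) > E} \<union> {W\<in>I. mdist (M W) (\<pi> W x) (\<pi> W a) > E}"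
  proof safe
    fix W assume W: "W \<in> I" "100 * E < dist_tuple u W y" "\<not> E < mdist (M W) (\<pi> W x) (\<pi> W a)"
    show "E < mdist (M W) (\<pi> W x) (\<pi> W y)"
    proof (rule ccontr)
      assume xy: "\<not> ?thesis"
      have "mdist (M W) (\<pi> W (u W)) (\<pi> W x) \<le> E + 2 * 0 + E + 1"
        using W x by (intro gate_close_of_proj_close[OF W(1) _ a]) (auto simp: mdist_commute[of _ "\<pi> W a"] mdist_self)
      moreover have "dist_tuple u W y \<le> mdist (M W) (\<pi> W x) (\<pi> W y) + mdist (M W) (\<pi> W (u W)) (\<pi> W x)"
        using triangle[of "\<pi> W y" W "\<pi> W x" "\<pi> W (u W)"] W(1) x y
        by (simp add: dist_tuple_def mdist_commute[of _ "\<pi> W x"])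
      ultimately show False using W(2) xy E_ge_1 by linarith
    qed
  qed
  then show ?thesis
    using finite_relevant[OF x y] finite_relevant[OF x A_in[OF a]] finite_subset by blast
qed

end

text \<open>\<open>10 * E\<close> is the consistency constant of the tuple. \<open>100 * E\<close>
  is ten times that, as realization requires, and the threshold of \<open>gate_finite\<close>. The
  last \<open>E\<close> passes from \<open>\<pi> W (u W)\<close> to
  \<open>\<beta> W\<close>.\<close>

definition gate_constant :: real where
  "gate_constant = realization_constant (10 * E) (100 * E) + E"

text \<open>The tolerance \<open>t\<close> is a parameter so that realized points and points of
  \<open>H_theta\<close> can be compared as gates of the same kind. In each domain any near
  projection is allowed.\<close>

definition is_gate :: "real \<Rightarrow> 'x set \<Rightarrow> 'x \<Rightarrow> 'x \<Rightarrow> bool" where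
  "is_gate t A x y \<longleftrightarrow> y \<in> mspace X \<and>
     (\<forall>W\<in>I. \<exists>b. near_projection (M W) (coord_hull A W) (\<pi> W x) b \<and> mdist (M W) (\<pi> W y) b \<le> t)"

lemma gate_exists:
  assumes A: "A \<subseteq> mspace X" "A \<noteq> {}" and x: "x \<in> mspace X"
  obtains y where "is_gate gate_constant A x y"
proof -
  have "\<exists>b v. near_projection (M W) (coord_hull A W) (\<pi> W x) b \<and> v \<in> mspace X \<and> mdist (M W) b (\<pi> W v) \<le> E"
    if W: "W \<in> I" for W
  proof -
    have "coord_hull A W \<noteq> {}" using proj_in_hull[OF A(1) W] A(2) by blast
    then obtain b where b: "near_projection (M W) (coord_hull A W) (\<pi> W x) b"
      using near_projection_exists by metis
    then have "b \<in> geodesic_hull (M W) (\<pi> W ` A)" by (simp add: near_projection_def coord_hull_def)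
    then obtain p q g where "p \<in> \<pi> W ` A" "q \<in> \<pi> W ` A" "geodesic_segment (M W) p q g" "b \<in> g"
      by (rule geodesic_hullE)
    \<comment> \<open>The projection lies on a geodesic between two coordinates of points of
      \<open>A\<close>, so quasiconvexity of the image of \<open>X\<close> supplies a point
      representing it.\<close>
    then have "\<exists>v\<in>mspace X. mdist (M W) b (\<pi> W v) \<le> E"
      using proj_quasiconvex[OF W] A(1) by blast
    then show ?thesis using b by blast
  qed
  then obtain \<beta> u where \<beta>: "\<And>W. W \<in> I \<Longrightarrow> near_projection (M W) (coord_hull A W) (\<pi> W x) (\<beta> W)"
    and u: "\<And>W. W \<in> I \<Longrightarrow> u W \<in> mspace X" "\<And>W. W \<in> I \<Longrightarrow> mdist (M W) (\<beta> W) (\<pi> W (u W)) \<le> E"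
    by metis
  have "\<exists>y\<in>mspace X. \<forall>W\<in>I. dist_tuple u W y \<le> realization_constant (10 * E) (100 * E)"
    using E_ge_1 gate_consistent[OF A x \<beta> u] gate_finite[OF A x \<beta> u] by (intro realization) auto
  then obtain y where y: "y \<in> mspace X"
    "\<And>W. W \<in> I \<Longrightarrow> dist_tuple u W y \<le> realization_constant (10 * E) (100 * E)" by blast
  have "mdist (M W) (\<pi> W y) (\<beta> W) \<le> gate_constant" if W: "W \<in> I" for W
  proof -
    have "\<beta> W \<in> mspace (M W)" using \<beta>[OF W] coord_hull_in by (auto simp: near_projection_def)
    then have "mdist (M W) (\<pi> W y) (\<beta> W) \<le> dist_tuple u W y + mdist (M W) (\<beta> W) (\<pi> W (u W))"
      using triangle[of "\<pi> W y" W "\<pi> W (u W)" "\<beta> W"] W y(1) u(1)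
      by (simp add: dist_tuple_def mdist_commute[of _ "\<beta> W"])
    then show ?thesis using y(2)[OF W] u(2)[OF W] by (simp add: gate_constant_def)
  qed
  then have "is_gate gate_constant A x y" unfolding is_gate_def using y(1) \<beta> by blast
  then show ?thesis by (rule that)
qed

text \<open>The coordinates of both gates are within \<open>t\<close> of near projections, whose
  distance \<open>near_projections_close\<close> bounds independently of the domain; uniqueness
  turns this into a bound in \<open>X\<close>. One \<open>\<Theta>\<close> serves all sets and
  points, as subdivision requires, and also absorbs the freedom in choosing gates.\<close>

lemma gates_close:
  obtains \<Theta> where "0 \<le> \<Theta>" "\<And>A A' x x' y y'. \<lbrakk>A \<subseteq> mspace X; A' \<subseteq> mspace X; x \<in> mspace X; x' \<in> mspace X;
    mdist X x x' \<le> r; \<And>a. a \<in> A \<Longrightarrow> \<exists>a'\<in>A'. mdist X a a' \<le> r; \<And>a'. a' \<in> A' \<Longrightarrow> \<exists>a\<in>A. mdist X a' a \<le> r;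
    is_gate t A x y; is_gate t A' x' y'\<rbrakk> \<Longrightarrow> mdist X y y' \<le> \<Theta>"
proof -
  define s where "s = E * r + E"
  define \<kappa> where "\<kappa> = 2 * t + (9 * s + 18 * E + 2)"
  obtain \<Theta> where \<Theta>: "\<And>y y'. y \<in> mspace X \<Longrightarrow> y' \<in> mspace X \<Longrightarrow>
      (\<And>W. W \<in> I \<Longrightarrow> mdist (M W) (\<pi> W y) (\<pi> W y') < \<kappa> + 1) \<Longrightarrow> mdist X y y' \<le> \<Theta>"
    using uniqueness[of "\<kappa> + 1"] by blast
  have "mdist X y y' \<le> max 0 \<Theta>"
    if sub: "A \<subseteq> mspace X" "A' \<subseteq> mspace X" and x: "x \<in> mspace X" "x' \<in> mspace X"
      and xx': "mdist X x x' \<le> r" and AA': "\<And>a. a \<in> A \<Longrightarrow> \<exists>a'\<in>A'. mdist X a a' \<le> r"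
      and A'A: "\<And>a'. a' \<in> A' \<Longrightarrow> \<exists>a\<in>A. mdist X a' a \<le> r"
      and gate: "is_gate t A x y" "is_gate t A' x' y'" for A A' x x' y y'
  proof -
    have y: "y \<in> mspace X" "y' \<in> mspace X" using gate by (auto simp: is_gate_def)
    have "mdist (M W) (\<pi> W y) (\<pi> W y') < \<kappa> + 1" if W: "W \<in> I" for W
    proof -
      have lip: "mdist (M W) (\<pi> W a) (\<pi> W a') \<le> s"
        if "a \<in> mspace X" "a' \<in> mspace X" "mdist X a a' \<le> r" for a a'
        using proj_Lipschitz[OF W that(1,2)] mult_left_mono[OF that(3), of E] E_ge_1
        unfolding s_def by linarith
      obtain b where b: "near_projection (M W) (coord_hull A W) (\<pi> W x) b" "mdist (M W) (\<pi> W y) b \<le> t"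
        using gate(1) W unfolding is_gate_def by blast
      obtain b' where b': "near_projection (M W) (coord_hull A' W) (\<pi> W x') b'" "mdist (M W) (\<pi> W y') b' \<le> t"
        using gate(2) W unfolding is_gate_def by blast
      have bm: "b \<in> mspace (M W)" "b' \<in> mspace (M W)"
        using b(1) b'(1) coord_hull_in by (auto simp: near_projection_def)
      have "mdist (M W) b b' \<le> 9 * s + 18 * E + 2"
      proof (rule slim_space.near_projections_close[OF slim_space[OF W]])
        show "\<pi> W ` A \<subseteq> mspace (M W)" "\<pi> W ` A' \<subseteq> mspace (M W)" using sub W by auto
        show "near_projection (M W) (geodesic_hull (M W) (\<pi> W ` A)) (\<pi> W x) b"
          "near_projection (M W) (geodesic_hull (M W) (\<pi> W ` A')) (\<pi> W x') b'"
          using b(1) b'(1) by (simp_all add: coord_hull_def)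
        show "mdist (M W) (\<pi> W x) (\<pi> W x') \<le> s" using lip x xx' by blast
        fix p
        show "\<exists>p'\<in>\<pi> W ` A'. mdist (M W) p p' \<le> s" if p: "p \<in> \<pi> W ` A"
        proof -
          obtain a where a: "a \<in> A" "p = \<pi> W a" using p by blast
          then obtain a' where "a' \<in> A'" "mdist X a a' \<le> r" using AA' by blast
          then show ?thesis using lip[of a a'] a sub by blast
        qed
        show "\<exists>p'\<in>\<pi> W ` A. mdist (M W) p p' \<le> s" if p: "p \<in> \<pi> W ` A'"
        proof -
          obtain a where a: "a \<in> A'" "p = \<pi> W a" using p by blast
          then obtain a' where "a' \<in> A" "mdist X a a' \<le> r" using A'A by blast
          then show ?thesis using lip[of a a'] a sub by blast
        qed
      qed (use W x in auto)
      moreover have "mdist (M W) (\<pi> W y) (\<pi> W y') \<le> mdist (M W) (\<pi> W y) b + mdist (M W) b (\<pi> W y')"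
        "mdist (M W) b (\<pi> W y') \<le> mdist (M W) b b' + mdist (M W) (\<pi> W y') b'"
        using W y bm triangle[of b W b' "\<pi> W y'"]
        by (simp_all add: triangle mdist_commute[of _ "\<pi> W y'" b'])
      ultimately show ?thesis using b(2) b'(2) by (simp add: \<kappa>_def)
    qed
    then show ?thesis using \<Theta>[OF y] by force
  qed
  then show ?thesis by (rule that[OF max.cobounded1])
qed

end

section \<open>Choosing points in the coordinate spaces\<close>

text \<open>The infimum need not be attained, hence the 1; the absolute value is needed because
  \<open>ennreal\<close> sends negative reals to 0.\<close>

lemma set_dist_leD:
  assumes "set_dist m P Q \<le> ennreal r"
  obtains p q where "p \<in> P" "q \<in> Q" "mdist m p q \<le> \<bar>r\<bar> + 1"
proof -
  have "set_dist m P Q < ennreal (\<bar>r\<bar> + 1)"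
    using assms by (rule le_less_trans) (rule ennreal_lessI; linarith)
  then obtain p q where "p \<in> P" "q \<in> Q" "ennreal (mdist m p q) < ennreal (\<bar>r\<bar> + 1)"
    unfolding set_dist_def INF_less_iff by blast
  then show ?thesis using that by (simp add: ennreal_less_iff del: ennreal_plus)
qed

lemma set_dist_leI: "p \<in> P \<Longrightarrow> q \<in> Q \<Longrightarrow> mdist m p q \<le> r \<Longrightarrow> set_dist m P Q \<le> ennreal r"
  unfolding set_dist_def by (meson INF_lower2 ennreal_leI)

lemma set_diam_leD:
  assumes "set_diam m P \<le> ennreal r" "p \<in> P" "q \<in> P"
  shows "mdist m p q \<le> \<bar>r\<bar>"
proof -
  have "ennreal (mdist m p q) \<le> ennreal r"
    using assms unfolding set_diam_def by (meson SUP_le_iff)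
  also have "\<dots> \<le> ennreal \<bar>r\<bar>" by (rule ennreal_leI) simp
  finally show ?thesis by simp
qed

lemma set_dist_le_points:
  assumes dist: "set_dist m P Q \<le> ennreal r"
    and P: "P \<subseteq> mspace m" "set_diam m P \<le> ennreal \<xi>" "p \<in> P"
    and Q: "Q \<subseteq> mspace m" "set_diam m Q \<le> ennreal \<xi>" "q \<in> Q"
  shows "mdist m p q \<le> \<bar>r\<bar> + 1 + 2 * \<bar>\<xi>\<bar>"
proof -
  obtain p' q' where p'q': "p' \<in> P" "q' \<in> Q" "mdist m p' q' \<le> \<bar>r\<bar> + 1"
    using set_dist_leD[OF dist] .
  have "mdist m p q \<le> mdist m p p' + mdist m p' q" "mdist m p' q \<le> mdist m p' q' + mdist m q' q"
    using P Q p'q' by (auto intro: mdist_triangle)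
  then show ?thesis
    using p'q'(3) set_diam_leD[OF P(2,3) p'q'(1)] set_diam_leD[OF Q(2) p'q'(2) Q(3)] by linarith
qed

lemma neighborhoodD:
  assumes "z \<in> neighborhood m r A"
  obtains a where "a \<in> A" "mdist m z a \<le> \<bar>r\<bar> + 1"
  using assms set_dist_leD[of m "{z}" A r] unfolding neighborhood_def by blast

lemma hyperbolic_slim_space:
  assumes hyp: "hyperbolic_geodesic_space \<delta> m" and D: "\<bar>\<delta>\<bar> + 1 \<le> D"
  shows "slim_space m D"
proof
  show "geodesic_space m" using hyp by (simp add: hyperbolic_geodesic_space_def)
  fix x y z g h k u
  assume "geodesic_segment m x y g" "geodesic_segment m y z h" "geodesic_segment m z x k" and u: "u \<in> g"
  then have "g \<subseteq> neighborhood m \<delta> (h \<union> k)"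
    using hyp unfolding hyperbolic_geodesic_space_def by blast
  then have "u \<in> neighborhood m \<delta> (h \<union> k)" using u by blast
  then obtain v where "v \<in> h \<union> k" "mdist m u v \<le> \<bar>\<delta>\<bar> + 1" by (rule neighborhoodD)
  then show "\<exists>v\<in>h \<union> k. mdist m u v \<le> D" using D by (meson order_trans)
qed

section \<open>Levels, orthogonal families and finiteness of the relevant domains\<close>

definition nest_chain :: "('x, 'i, 'c) hhs_structure \<Rightarrow> 'i set \<Rightarrow> bool" where
  "nest_chain \<SS> C \<longleftrightarrow> (\<forall>V\<in>C. \<forall>W\<in>C. (V, W) \<in> nest \<SS> \<or> (W, V) \<in> nest \<SS>)"

text \<open>The largest size of a nesting chain below \<open>W\<close>: a rank function that is
  strictly monotone under proper nesting and bounded by the complexity.\<close>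

definition hhs_level :: "('x, 'i, 'c) hhs_structure \<Rightarrow> 'i \<Rightarrow> nat" where
  "hhs_level \<SS> W = Max (card ` {C. C \<subseteq> nested_in \<SS> W \<and> nest_chain \<SS> C})"

locale hhs_order =
  fixes \<SS> :: "('x, 'i, 'c) hhs_structure" and \<xi> :: real and n :: nat
  assumes nesting: "hhs_nesting \<SS> \<xi>" and orthogonality: "hhs_orthogonality \<SS>"
    and complexity: "\<And>\<V>. \<V> \<subseteq> index \<SS> \<Longrightarrow> nest_chain \<SS> \<V> \<Longrightarrow> finite \<V> \<and> card \<V> \<le> n"
begin

lemma nest_index: "(V, W) \<in> nest \<SS> \<Longrightarrow> V \<in> index \<SS> \<and> W \<in> index \<SS>"
  and nest_refl: "W \<in> index \<SS> \<Longrightarrow> (W, W) \<in> nest \<SS>"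
  and nest_trans: "(U, V) \<in> nest \<SS> \<Longrightarrow> (V, W) \<in> nest \<SS> \<Longrightarrow> (U, W) \<in> nest \<SS>"
  and nest_antisym: "(V, W) \<in> nest \<SS> \<Longrightarrow> (W, V) \<in> nest \<SS> \<Longrightarrow> V = W"
  using nesting unfolding hhs_nesting_def partial_order_on_def preorder_on_def refl_on_def
  by (auto dest: transD antisymD)

lemma finite_chain_cards: "finite (card ` {C. C \<subseteq> nested_in \<SS> W \<and> nest_chain \<SS> C})"
  and chain_card_le: "C \<subseteq> nested_in \<SS> W \<Longrightarrow> nest_chain \<SS> C \<Longrightarrow> card C \<le> hhs_level \<SS> W"
proof -
  have "nested_in \<SS> W \<subseteq> index \<SS>" by (auto simp: nested_in_def)
  then have "card ` {C. C \<subseteq> nested_in \<SS> W \<and> nest_chain \<SS> C} \<subseteq> {..n}"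
    using complexity by force
  then show fin: "finite (card ` {C. C \<subseteq> nested_in \<SS> W \<and> nest_chain \<SS> C})"
    by (rule finite_subset) simp
  show "card C \<le> hhs_level \<SS> W" if "C \<subseteq> nested_in \<SS> W" "nest_chain \<SS> C"
    unfolding hhs_level_def using that by (intro Max_ge[OF fin]) blast
qed

lemma level_attained:
  obtains C where "C \<subseteq> nested_in \<SS> W" "nest_chain \<SS> C" "card C = hhs_level \<SS> W" "finite C" "card C \<le> n"
proof -
  have "{} \<in> {C. C \<subseteq> nested_in \<SS> W \<and> nest_chain \<SS> C}" by (simp add: nest_chain_def)
  then have "hhs_level \<SS> W \<in> card ` {C. C \<subseteq> nested_in \<SS> W \<and> nest_chain \<SS> C}"
    unfolding hhs_level_def using finite_chain_cards by (intro Max_in) blast+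
  then obtain C where C: "C \<subseteq> nested_in \<SS> W" "nest_chain \<SS> C" "card C = hhs_level \<SS> W" by force
  moreover have "C \<subseteq> index \<SS>" using C(1) by (auto simp: nested_in_def)
  ultimately show ?thesis using that complexity by blast
qed

lemma level_le: "hhs_level \<SS> W \<le> n"
  using level_attained by metis

text \<open>A longest chain below \<open>V\<close> can be extended by \<open>W\<close>.\<close>

lemma level_less:
  assumes "pnested \<SS> V W"
  shows "hhs_level \<SS> V < hhs_level \<SS> W"
proof -
  have VW: "(V, W) \<in> nest \<SS>" "V \<noteq> W" using assms by (auto simp: pnested_def)
  obtain C where C: "C \<subseteq> nested_in \<SS> V" "nest_chain \<SS> C" "card C = hhs_level \<SS> V" "finite C"
    using level_attained[of V] by metis
  have CW: "(U, W) \<in> nest \<SS> \<and> U \<in> index \<SS>" if "U \<in> C" for U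
    using that C(1) VW nest_trans unfolding nested_in_def by blast
  have "W \<notin> C" using C(1) VW nest_antisym unfolding nested_in_def by blast
  moreover have "nest_chain \<SS> (insert W C)"
    using C(2) CW nest_refl nest_index[OF VW(1)] unfolding nest_chain_def by blast
  moreover have "insert W C \<subseteq> nested_in \<SS> W"
    using CW nest_refl nest_index[OF VW(1)] unfolding nested_in_def by blast
  ultimately show ?thesis using chain_card_le[of "insert W C" W] C(3,4) by simp
qed

text \<open>The unique maximal element is a greatest one: from any \<open>W\<close> an element of
  largest level above it is maximal, hence equals \<open>S\<close>.\<close>

lemma index_nested_in_top:
  assumes "index \<SS> \<noteq> {}"
  obtains S where "S \<in> index \<SS>" "nested_in \<SS> S = index \<SS>"
proof -
  obtain S where S: "S \<in> index \<SS>"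
    "\<And>W. W \<in> index \<SS> \<Longrightarrow> (\<And>U. U \<in> index \<SS> \<Longrightarrow> (W, U) \<in> nest \<SS> \<Longrightarrow> U = W) \<Longrightarrow> W = S"
    using nesting assms unfolding hhs_nesting_def by metis
  have "(W, S) \<in> nest \<SS>" if W: "W \<in> index \<SS>" for W
  proof -
    have "\<forall>V. (W, V) \<in> nest \<SS> \<longrightarrow> hhs_level \<SS> V < Suc n" using level_le by (simp add: le_imp_less_Suc)
    then obtain V where V: "(W, V) \<in> nest \<SS>"
      "\<And>U. (W, U) \<in> nest \<SS> \<Longrightarrow> hhs_level \<SS> U \<le> hhs_level \<SS> V"
      using ex_has_greatest_nat[of "\<lambda>V. (W, V) \<in> nest \<SS>" W "hhs_level \<SS>" "Suc n"] nest_refl[OF W]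
      by blast
    have "U = V" if "(V, U) \<in> nest \<SS>" for U
      using level_less[of V U] V(2)[OF nest_trans[OF V(1) that]] that by (auto simp: pnested_def)
    then have "V = S" using S(2) nest_index V(1) by blast
    then show ?thesis using V(1) by blast
  qed
  then have "nested_in \<SS> S = index \<SS>" by (auto simp: nested_in_def)
  then show ?thesis using that S(1) by blast
qed

text \<open>Remove one member \<open>U\<close>. The others lie in a container properly nested in
  \<open>T\<close>, whose level is smaller.\<close>

lemma orthogonal_card_le_level:
  assumes "finite F" "F \<subseteq> nested_in \<SS> T" "\<And>V W. V \<in> F \<Longrightarrow> W \<in> F \<Longrightarrow> V \<noteq> W \<Longrightarrow> (V, W) \<in> orth \<SS>"
  shows "card F \<le> hhs_level \<SS> T"
  using assms
proof (induction F arbitrary: T rule: finite_induct)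
  case (insert U F)
  have U: "U \<in> nested_in \<SS> T" using insert.prems by blast
  have T: "T \<in> index \<SS>" using U nest_index by (auto simp: nested_in_def)
  show ?case
  proof (cases "F = {}")
    case True
    have "card {T} \<le> hhs_level \<SS> T"
      by (rule chain_card_le) (use T nest_refl in \<open>auto simp: nested_in_def nest_chain_def\<close>)
    then show ?thesis using True by simp
  next
    case False
    have FU: "(V, U) \<in> orth \<SS>" "V \<in> nested_in \<SS> T" if "V \<in> F" for V
      using that insert.prems insert.hyps by blast+
    then have "{V \<in> nested_in \<SS> T. (V, U) \<in> orth \<SS>} \<noteq> {}" using False by blast
    then obtain W where W: "W \<in> nested_in \<SS> T - {T}"
      "\<And>V. (V, U) \<in> orth \<SS> \<Longrightarrow> (V, T) \<in> nest \<SS> \<Longrightarrow> (V, W) \<in> nest \<SS>"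
      using orthogonality T U unfolding hhs_orthogonality_def by meson
    have "F \<subseteq> nested_in \<SS> W" using FU W(2) unfolding nested_in_def by blast
    then have "card F \<le> hhs_level \<SS> W" using insert.IH insert.prems by blast
    moreover have "hhs_level \<SS> W < hhs_level \<SS> T"
      using W(1) by (intro level_less) (auto simp: nested_in_def pnested_def)
    ultimately show ?thesis using insert.hyps by simp
  qed
qed simp

lemma orthogonal_family_bounded:
  assumes F: "F \<subseteq> index \<SS>" "\<And>V W. V \<in> F \<Longrightarrow> W \<in> F \<Longrightarrow> V \<noteq> W \<Longrightarrow> (V, W) \<in> orth \<SS>"
  shows "finite F \<and> card F \<le> n"
proof (cases "index \<SS> = {}")
  case False
  then obtain S where S: "nested_in \<SS> S = index \<SS>" by (rule index_nested_in_top)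
  have "card G \<le> n" if "G \<subseteq> F" "finite G" for G
  proof -
    have "card G \<le> hhs_level \<SS> S"
      by (rule orthogonal_card_le_level) (use that F S in blast)+
    then show ?thesis using level_le order_trans by blast
  qed
  then show ?thesis using finite_if_finite_subsets_card_bdd[of F n] by blast
qed (use F in simp)

lemma transverse_iff:
  "transverse \<SS> V W \<longleftrightarrow> V \<in> index \<SS> \<and> W \<in> index \<SS> \<and> V \<noteq> W \<and> \<not> pnested \<SS> V W \<and> \<not> pnested \<SS> W V
    \<and> (V, W) \<notin> orth \<SS>"
  using nest_refl unfolding transverse_def pnested_def by blast

text \<open>Large links put the relevant domains properly below \<open>W\<close> under finitely many
  domains of smaller level. Induction on the level, applied to the greatest domain, gives finiteness
  without a uniform count.\<close>

lemma finite_large_pdist: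
  assumes links: "\<And>W. W \<in> index \<SS> \<Longrightarrow> \<exists>\<T>\<subseteq>nested_in \<SS> W - {W}. finite \<T> \<and>
      (\<forall>T\<in>nested_in \<SS> W - {W}. (\<exists>T'\<in>\<T>. T \<in> nested_in \<SS> T') \<or> pdist \<SS> T x y < e)"
  shows "finite {W\<in>index \<SS>. \<not> pdist \<SS> W x y < e}"
proof -
  have "finite {T\<in>nested_in \<SS> W. \<not> pdist \<SS> T x y < e}" if "W \<in> index \<SS>" for W
    using that
  proof (induction "hhs_level \<SS> W" arbitrary: W rule: less_induct)
    case less
    obtain \<T> where \<T>: "\<T> \<subseteq> nested_in \<SS> W - {W}" "finite \<T>"
      "\<And>T. T \<in> nested_in \<SS> W - {W} \<Longrightarrow> (\<exists>T'\<in>\<T>. T \<in> nested_in \<SS> T') \<or> pdist \<SS> T x y < e"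
      using links[OF less.prems] by blast
    have "finite {T\<in>nested_in \<SS> T'. \<not> pdist \<SS> T x y < e}" if "T' \<in> \<T>" for T'
      using that \<T>(1) by (intro less.hyps level_less) (auto simp: nested_in_def pnested_def)
    then have "finite ({W} \<union> (\<Union>T'\<in>\<T>. {T\<in>nested_in \<SS> T'. \<not> pdist \<SS> T x y < e}))"
      using \<T>(2) by blast
    then show ?case by (rule rev_finite_subset) (use \<T>(3) in blast)
  qed
  then show ?thesis
    by (cases "index \<SS> = {}") (simp, metis index_nested_in_top)
qed

end

definition choose_proj :: "('x, 'i, 'c) hhs_structure \<Rightarrow> 'i \<Rightarrow> 'x \<Rightarrow> 'c" where
  "choose_proj \<SS> W x = (SOME p. p \<in> proj \<SS> W x)"

definition choose_rho :: "('x, 'i, 'c) hhs_structure \<Rightarrow> 'i \<Rightarrow> 'i \<Rightarrow> 'c" where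
  "choose_rho \<SS> V W = (SOME p. p \<in> rho_set \<SS> V W)"

definition choose_rho_map :: "('x, 'i, 'c) hhs_structure \<Rightarrow> 'i \<Rightarrow> 'i \<Rightarrow> 'c \<Rightarrow> 'c" where
  "choose_rho_map \<SS> W V p = (SOME q. q \<in> rho_map \<SS> W V p)"

lemma (in hhs_order) coarse_hhs_choice:
  assumes ne: "mspace X \<noteq> {}"
    and hyp: "\<And>W. W \<in> index \<SS> \<Longrightarrow> hyperbolic_geodesic_space \<delta> (cspace \<SS> W)"
    and projections: "hhs_projections X \<SS> \<xi> K"
    and consistency: "hhs_consistency X \<SS> \<xi> \<kappa>\<^sub>0"
    and links: "hhs_large_links X \<SS> \<xi> \<kappa>\<^sub>0"
    and bgi: "hhs_bounded_geodesic_image \<SS>"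
    and realization: "hhs_partial_realization X \<SS>"
    and uniqueness: "hhs_uniqueness X \<SS>"
  obtains E where "\<bar>\<xi>\<bar> \<le> E"
    "coarse_hhs X (index \<SS>) (cspace \<SS>) (pnested \<SS>) (\<lambda>V W. (V, W) \<in> orth \<SS>)
      (choose_proj \<SS>) (choose_rho \<SS>) (choose_rho_map \<SS>) E (hhs_level \<SS>) n (transverse \<SS>)"
proof -
  have nonneg: "0 \<le> \<xi>" "0 \<le> K" "0 \<le> \<kappa>\<^sub>0"
    using projections consistency by (auto simp: hhs_projections_def hhs_consistency_def)
  obtain e1 where links: "\<And>W x x'. W \<in> index \<SS> \<Longrightarrow> x \<in> mspace X \<Longrightarrow> x' \<in> mspace X \<Longrightarrow>
      \<exists>\<T>\<subseteq>nested_in \<SS> W - {W}. finite \<T> \<and>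
        (\<forall>T\<in>nested_in \<SS> W - {W}. (\<exists>T'\<in>\<T>. T \<in> nested_in \<SS> T') \<or> pdist \<SS> T x x' < ennreal e1)"
    using links unfolding hhs_large_links_def Let_def by meson
  obtain e2 where e2: "0 < e2" and bgi': "\<forall>V W x y g. pnested \<SS> V W \<and> geodesic_segment (cspace \<SS> W) x y g \<longrightarrow>
        set_diam (cspace \<SS> V) (rho_image \<SS> W V g) \<le> ennreal e2 \<or>
        g \<inter> neighborhood (cspace \<SS> W) e2 (rho_set \<SS> V W) \<noteq> {}"
    using bgi unfolding hhs_bounded_geodesic_image_def by (elim exE conjE)
  have bgi: "set_diam (cspace \<SS> V) (rho_image \<SS> W V g) \<le> ennreal e2 \<or>
        g \<inter> neighborhood (cspace \<SS> W) e2 (rho_set \<SS> V W) \<noteq> {}"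
    if "pnested \<SS> V W" "geodesic_segment (cspace \<SS> W) x y g" for V W x y g
    using bgi'[rule_format, of V W x y g] that by simp
  obtain \<alpha> :: real where realization': "\<forall>F\<subseteq>index \<SS>. \<forall>p.
      (\<forall>V\<in>F. \<forall>W\<in>F. V \<noteq> W \<longrightarrow> (V, W) \<in> orth \<SS>) \<and> (\<forall>V\<in>F. p V \<in> proj_set \<SS> V (mspace X)) \<longrightarrow>
      (\<exists>x\<in>mspace X. \<forall>V\<in>F. pdist_set \<SS> V x {p V} \<le> ennreal \<alpha> \<and>
           (\<forall>W. pnested \<SS> V W \<or> transverse \<SS> W V \<longrightarrow> pdist_set \<SS> W x (rho_set \<SS> V W) \<le> ennreal \<alpha>))"
    using realization unfolding hhs_partial_realization_def by (elim exE)
  have realization: "\<exists>x\<in>mspace X. \<forall>V\<in>F. pdist_set \<SS> V x {p V} \<le> ennreal \<alpha> \<and>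
           (\<forall>W. pnested \<SS> V W \<or> transverse \<SS> W V \<longrightarrow> pdist_set \<SS> W x (rho_set \<SS> V W) \<le> ennreal \<alpha>)"
    if "F \<subseteq> index \<SS>" "\<And>V W. V \<in> F \<Longrightarrow> W \<in> F \<Longrightarrow> V \<noteq> W \<Longrightarrow> (V, W) \<in> orth \<SS>"
      "\<And>V. V \<in> F \<Longrightarrow> p V \<in> proj_set \<SS> V (mspace X)" for F p
    using realization'[rule_format, of F p] that by simp
  \<comment> \<open>Each constant comes with room for an unattained infimum (1) and for passing from
    sets of diameter at most \<open>\<xi>\<close> to chosen points
    (\<open>2 * \<xi>\<close>).\<close>
  define E where "E = \<bar>\<delta>\<bar> + K + \<kappa>\<^sub>0 + \<bar>e1\<bar> + e2 + \<bar>\<alpha>\<bar> + 2 * \<xi> + 2"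
  have E: "1 \<le> E" "\<bar>\<xi>\<bar> \<le> E" "\<bar>\<delta>\<bar> + 1 \<le> E" "K + 1 + 2 * \<xi> \<le> E" "\<bar>\<kappa>\<^sub>0\<bar> + 1 + 2 * \<xi> \<le> E" "\<bar>\<kappa>\<^sub>0\<bar> \<le> E"
    "\<bar>e1\<bar> + 1 + 2 * \<xi> \<le> E" "e2 + 1 + \<xi> \<le> E" "e2 \<le> E" "\<bar>\<alpha>\<bar> + 1 + 2 * \<xi> \<le> E" "K \<le> E"
    using nonneg e2 by (auto simp: E_def)
  have proj_sub: "proj \<SS> W x \<subseteq> mspace (cspace \<SS> W)" and proj_ne: "proj \<SS> W x \<noteq> {}"
    and proj_diam: "set_diam (cspace \<SS> W) (proj \<SS> W x) \<le> ennreal \<xi>"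
    if "W \<in> index \<SS>" "x \<in> mspace X" for W x
    using projections that by (simp_all add: hhs_projections_def)
  have proj_Lip: "set_coarsely_Lipschitz_on K K X (cspace \<SS> W) (proj \<SS> W)"
    and proj_qc: "quasiconvex K (cspace \<SS> W) (proj_set \<SS> W (mspace X))" if "W \<in> index \<SS>" for W
    using projections that by (simp_all add: hhs_projections_def)
  let ?\<pi> = "choose_proj \<SS>" and ?\<rho> = "choose_rho \<SS>" and ?\<sigma> = "choose_rho_map \<SS>"
  have \<pi>: "?\<pi> W x \<in> proj \<SS> W x" if "W \<in> index \<SS>" "x \<in> mspace X" for W x
    using proj_ne[OF that] unfolding choose_proj_def by (simp add: some_in_eq)
  have pn_I: "V \<in> index \<SS> \<and> W \<in> index \<SS>" if "pnested \<SS> V W" for V W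
    using nest_index that unfolding pnested_def by blast
  have tr_I: "V \<in> index \<SS> \<and> W \<in> index \<SS>" if "transverse \<SS> V W" for V W
    using that unfolding transverse_def by blast
  have orth_sym: "(V, W) \<in> orth \<SS> \<Longrightarrow> (W, V) \<in> orth \<SS>" for V W
    using orthogonality unfolding hhs_orthogonality_def by (meson symD)
  have tr_sym: "transverse \<SS> V W \<Longrightarrow> transverse \<SS> W V" for V W
    using orth_sym unfolding transverse_def by blast
  have rho_sub: "rho_set \<SS> V W \<subseteq> mspace (cspace \<SS> W)"
    and rho_diam: "set_diam (cspace \<SS> W) (rho_set \<SS> V W) \<le> ennreal \<xi>"
    if "pnested \<SS> V W \<or> transverse \<SS> V W" for V W
    using that nesting consistency unfolding hhs_nesting_def hhs_consistency_def by blast+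
  have rho_ne: "rho_set \<SS> V W \<noteq> {}" if VW: "pnested \<SS> V W \<or> transverse \<SS> V W" for V W
  proof -
    have V: "V \<in> index \<SS>" using VW pn_I tr_I by blast
    obtain x0 where x0: "x0 \<in> mspace X" using ne by blast
    have p: "?\<pi> V x0 \<in> proj_set \<SS> V (mspace X)" using \<pi>[OF V x0] x0 unfolding proj_set_def by blast
    have "\<exists>x\<in>mspace X. \<forall>V\<in>{V}. pdist_set \<SS> V x {?\<pi> V x0} \<le> ennreal \<alpha> \<and>
           (\<forall>W. pnested \<SS> V W \<or> transverse \<SS> W V \<longrightarrow> pdist_set \<SS> W x (rho_set \<SS> V W) \<le> ennreal \<alpha>)"
      using V p by (intro realization[of "{V}" "\<lambda>V. ?\<pi> V x0"]) auto
    then obtain x where "pdist_set \<SS> W x (rho_set \<SS> V W) \<le> ennreal \<alpha>" using VW tr_sym by blast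
    then show ?thesis unfolding pdist_set_def by (metis set_dist_leD empty_iff)
  qed
  have \<rho>: "?\<rho> V W \<in> rho_set \<SS> V W" if "pnested \<SS> V W \<or> transverse \<SS> V W" for V W
    using rho_ne[OF that] unfolding choose_rho_def by (simp add: some_in_eq)
  have \<sigma>: "?\<sigma> W V p \<in> rho_map \<SS> W V p" "rho_map \<SS> W V p \<subseteq> mspace (cspace \<SS> V)"
    if "pnested \<SS> V W" "p \<in> mspace (cspace \<SS> W)" for V W p
  proof -
    have "rho_map \<SS> W V p \<noteq> {}" using nesting that unfolding hhs_nesting_def by blast
    then show "?\<sigma> W V p \<in> rho_map \<SS> W V p" unfolding choose_rho_map_def by (simp add: some_in_eq)
    show "rho_map \<SS> W V p \<subseteq> mspace (cspace \<SS> V)" using nesting that unfolding hhs_nesting_def by blast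
  qed
  have \<pi>\<rho>: "mdist (cspace \<SS> W) (?\<pi> W x) (?\<rho> V W) \<le> E"
    if "pdist_set \<SS> W x (rho_set \<SS> V W) \<le> ennreal r" "r = \<alpha> \<or> r = \<kappa>\<^sub>0" "x \<in> mspace X"
      "pnested \<SS> V W \<or> transverse \<SS> V W" for V W x r
  proof -
    have W: "W \<in> index \<SS>" using that pn_I tr_I by blast
    have "mdist (cspace \<SS> W) (?\<pi> W x) (?\<rho> V W) \<le> \<bar>r\<bar> + 1 + 2 * \<bar>\<xi>\<bar>"
      using that(1) unfolding pdist_set_def
      by (rule set_dist_le_points)
        (use W that(3,4) proj_sub proj_diam \<pi> rho_sub rho_diam \<rho> in blast)+
    then show ?thesis using that(2) E nonneg by auto
  qed
  have "coarse_hhs X (index \<SS>) (cspace \<SS>) (pnested \<SS>) (\<lambda>V W. (V, W) \<in> orth \<SS>)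
      ?\<pi> ?\<rho> ?\<sigma> E (hhs_level \<SS>) n (transverse \<SS>)"
  proof (rule coarse_hhs.intro)
    show "slim_space (cspace \<SS> W) E" if "W \<in> index \<SS>" for W
      using hyperbolic_slim_space[OF hyp[OF that] E(3)] .
    show \<pi>_in: "?\<pi> W x \<in> mspace (cspace \<SS> W)" if "W \<in> index \<SS>" "x \<in> mspace X" for W x
      using \<pi>[OF that] proj_sub[OF that] by blast
    show "mdist (cspace \<SS> W) (?\<pi> W x) (?\<pi> W y) \<le> E * mdist X x y + E"
      if W: "W \<in> index \<SS>" and xy: "x \<in> mspace X" "y \<in> mspace X" for W x y
    proof -
      have "set_dist (cspace \<SS> W) (proj \<SS> W x) (proj \<SS> W y) \<le> ennreal (K * mdist X x y + K)"
        using proj_Lip[OF W] xy unfolding set_coarsely_Lipschitz_on_def by blast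
      then have "mdist (cspace \<SS> W) (?\<pi> W x) (?\<pi> W y) \<le> \<bar>K * mdist X x y + K\<bar> + 1 + 2 * \<bar>\<xi>\<bar>"
        by (rule set_dist_le_points) (use W xy proj_sub proj_diam \<pi> in blast)+
      moreover have "K * mdist X x y \<le> E * mdist X x y" "0 \<le> K * mdist X x y"
        using E nonneg by (auto intro: mult_right_mono)
      ultimately show ?thesis using E nonneg by linarith
    qed
    show "\<exists>u\<in>mspace X. mdist (cspace \<SS> W) z (?\<pi> W u) \<le> E"
      if W: "W \<in> index \<SS>" and xy: "x \<in> mspace X" "y \<in> mspace X"
        and g: "geodesic_segment (cspace \<SS> W) (?\<pi> W x) (?\<pi> W y) g" "z \<in> g" for W x y g z
    proof -
      have "?\<pi> W x \<in> proj_set \<SS> W (mspace X)" "?\<pi> W y \<in> proj_set \<SS> W (mspace X)"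
        using \<pi> W xy unfolding proj_set_def by blast+
      then have "g \<subseteq> neighborhood (cspace \<SS> W) K (proj_set \<SS> W (mspace X))"
        using proj_qc[OF W] g(1) unfolding quasiconvex_def by blast
      then obtain p where p: "p \<in> proj_set \<SS> W (mspace X)" "mdist (cspace \<SS> W) z p \<le> \<bar>K\<bar> + 1"
        using g(2) neighborhoodD[of z "cspace \<SS> W" K] by blast
      then obtain u where u: "u \<in> mspace X" "p \<in> proj \<SS> W u" unfolding proj_set_def by blast
      have "mdist (cspace \<SS> W) p (?\<pi> W u) \<le> \<bar>\<xi>\<bar>"
        using set_diam_leD[OF proj_diam[OF W u(1)] u(2) \<pi>[OF W u(1)]] .
      moreover have "p \<in> mspace (cspace \<SS> W)" using u proj_sub[OF W u(1)] by blast
      then have "mdist (cspace \<SS> W) z (?\<pi> W u) \<le> mdist (cspace \<SS> W) z p + mdist (cspace \<SS> W) p (?\<pi> W u)"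
        using geodesic_segment_in[OF g] \<pi>_in[OF W u(1)] by (intro mdist_triangle)
      ultimately show ?thesis using u(1) p(2) E nonneg by (intro bexI[of _ u]) linarith+
    qed
    show "pnested \<SS> U W" if "pnested \<SS> U V" "pnested \<SS> V W" for U V W
      using that nest_trans nest_antisym unfolding pnested_def by blast
    show "(V, V) \<notin> orth \<SS>" for V
      using orthogonality unfolding hhs_orthogonality_def by (meson irreflD)
    show "(V, W) \<in> orth \<SS> \<Longrightarrow> \<not> pnested \<SS> V W" for V W
      using orthogonality unfolding hhs_orthogonality_def pnested_def by blast
    show "pnested \<SS> V W \<Longrightarrow> (W, U) \<in> orth \<SS> \<Longrightarrow> (V, U) \<in> orth \<SS>" for U V W
      using orthogonality unfolding hhs_orthogonality_def pnested_def by blast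
    show "?\<rho> V W \<in> mspace (cspace \<SS> W)" if "pnested \<SS> V W \<or> transverse \<SS> V W" for V W
      using \<rho>[OF that] rho_sub[OF that] by blast
    show "?\<sigma> W V p \<in> mspace (cspace \<SS> V)" if "pnested \<SS> V W" "p \<in> mspace (cspace \<SS> W)" for V W p
      using \<sigma>[OF that] by blast
    show "mdist (cspace \<SS> W) (?\<pi> W x) (?\<rho> V W) \<le> E \<or> mdist (cspace \<SS> V) (?\<pi> V x) (?\<rho> W V) \<le> E"
      if "transverse \<SS> V W" "x \<in> mspace X" for V W x
    proof -
      have "pdist_set \<SS> W x (rho_set \<SS> V W) \<le> ennreal \<kappa>\<^sub>0 \<or> pdist_set \<SS> V x (rho_set \<SS> W V) \<le> ennreal \<kappa>\<^sub>0"
        using consistency that unfolding hhs_consistency_def min_le_iff_disj by blast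
      then show ?thesis using \<pi>\<rho>[of W x V] \<pi>\<rho>[of V x W] that tr_sym by blast
    qed
    show "mdist (cspace \<SS> W) (?\<pi> W x) (?\<rho> V W) \<le> E \<or>
        mdist (cspace \<SS> V) (?\<pi> V x) (?\<sigma> W V (?\<pi> W x)) \<le> E"
      if VW: "pnested \<SS> V W" and x: "x \<in> mspace X" for V W x
    proof -
      have I: "V \<in> index \<SS>" "W \<in> index \<SS>" using pn_I VW by blast+
      have "pdist_set \<SS> W x (rho_set \<SS> V W) \<le> ennreal \<kappa>\<^sub>0 \<or>
          set_diam (cspace \<SS> V) (proj \<SS> V x \<union> rho_image \<SS> W V (proj \<SS> W x)) \<le> ennreal \<kappa>\<^sub>0"
        using consistency VW x unfolding hhs_consistency_def min_le_iff_disj by blast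
      then show ?thesis
      proof
        assume diam: "set_diam (cspace \<SS> V) (proj \<SS> V x \<union> rho_image \<SS> W V (proj \<SS> W x)) \<le> ennreal \<kappa>\<^sub>0"
        have "?\<sigma> W V (?\<pi> W x) \<in> rho_image \<SS> W V (proj \<SS> W x)"
          using \<sigma>(1)[OF VW \<pi>_in[OF I(2) x]] \<pi>[OF I(2) x] unfolding rho_image_def by blast
        then have "mdist (cspace \<SS> V) (?\<pi> V x) (?\<sigma> W V (?\<pi> W x)) \<le> \<bar>\<kappa>\<^sub>0\<bar>"
          using set_diam_leD[OF diam UnI1[OF \<pi>[OF I(1) x]] UnI2] by blast
        then show ?thesis using E by linarith
      qed (use \<pi>\<rho> VW x in blast)
    qed
    show "mdist (cspace \<SS> W) (?\<rho> U W) (?\<rho> V W) \<le> E"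
      if UV: "pnested \<SS> U V" and VW: "transverse \<SS> V W" and UW: "transverse \<SS> U W" for U V W
    proof -
      have "(U, V) \<in> nest \<SS>" "(W, U) \<notin> orth \<SS>"
        using UV UW orth_sym unfolding pnested_def transverse_def by blast+
      then have "set_dist (cspace \<SS> W) (rho_set \<SS> U W) (rho_set \<SS> V W) \<le> ennreal \<kappa>\<^sub>0"
        using consistency VW unfolding hhs_consistency_def by blast
      then have "mdist (cspace \<SS> W) (?\<rho> U W) (?\<rho> V W) \<le> \<bar>\<kappa>\<^sub>0\<bar> + 1 + 2 * \<bar>\<xi>\<bar>"
        by (rule set_dist_le_points) (use VW UW rho_sub rho_diam \<rho> in blast)+
      then show ?thesis using E nonneg by linarith
    qed
    show "finite {W\<in>index \<SS>. mdist (cspace \<SS> W) (?\<pi> W x) (?\<pi> W y) > E}"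
      if x: "x \<in> mspace X" and y: "y \<in> mspace X" for x y
    proof (rule finite_subset[OF _ finite_large_pdist[of x y "ennreal e1"]])
      show "{W\<in>index \<SS>. mdist (cspace \<SS> W) (?\<pi> W x) (?\<pi> W y) > E}
          \<subseteq> {W\<in>index \<SS>. \<not> pdist \<SS> W x y < ennreal e1}"
      proof safe
        fix W assume W: "W \<in> index \<SS>" "E < mdist (cspace \<SS> W) (?\<pi> W x) (?\<pi> W y)"
          "pdist \<SS> W x y < ennreal e1"
        have "set_dist (cspace \<SS> W) (proj \<SS> W x) (proj \<SS> W y) \<le> ennreal e1"
          using W(3) unfolding pdist_def by simp
        then have "mdist (cspace \<SS> W) (?\<pi> W x) (?\<pi> W y) \<le> \<bar>e1\<bar> + 1 + 2 * \<bar>\<xi>\<bar>"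
          by (rule set_dist_le_points) (use W x y proj_sub proj_diam \<pi> in blast)+
        then show False using W(2) E nonneg by linarith
      qed
    qed (use links x y in blast)
    show "mdist (cspace \<SS> V) (?\<sigma> W V z) (?\<sigma> W V z') \<le> E"
      if VW: "pnested \<SS> V W" and g: "geodesic_segment (cspace \<SS> W) p q g"
        and far: "\<And>z. z \<in> g \<Longrightarrow> mdist (cspace \<SS> W) z (?\<rho> V W) > E" and z: "z \<in> g" "z' \<in> g"
      for V W p q g z z'
    proof -
      have "g \<inter> neighborhood (cspace \<SS> W) e2 (rho_set \<SS> V W) = {}"
      proof (rule ccontr)
        assume "\<not> ?thesis"
        then obtain w where w: "w \<in> g" "w \<in> neighborhood (cspace \<SS> W) e2 (rho_set \<SS> V W)" by blast
        then have "set_dist (cspace \<SS> W) {w} (rho_set \<SS> V W) \<le> ennreal e2"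
          unfolding neighborhood_def by blast
        then obtain v where v: "v \<in> rho_set \<SS> V W" "mdist (cspace \<SS> W) w v \<le> \<bar>e2\<bar> + 1"
          using set_dist_leD[of "cspace \<SS> W" "{w}" "rho_set \<SS> V W" e2] by blast
        have VW': "pnested \<SS> V W \<or> transverse \<SS> V W" using VW by blast
        have "mdist (cspace \<SS> W) v (?\<rho> V W) \<le> \<bar>\<xi>\<bar>"
          using set_diam_leD[OF rho_diam[OF VW'] v(1) \<rho>[OF VW']] .
        moreover have "mdist (cspace \<SS> W) w (?\<rho> V W)
            \<le> mdist (cspace \<SS> W) w v + mdist (cspace \<SS> W) v (?\<rho> V W)"
          using geodesic_segment_in[OF g w(1)] v(1) rho_sub[OF VW'] \<rho>[OF VW']
          by (intro mdist_triangle) auto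
        ultimately show False using far[OF w(1)] v(2) E e2 nonneg by linarith
      qed
      then have diam: "set_diam (cspace \<SS> V) (rho_image \<SS> W V g) \<le> ennreal e2" using bgi[OF VW g] by blast
      have "?\<sigma> W V w \<in> rho_image \<SS> W V g" if "w \<in> g" for w
        using \<sigma>(1)[OF VW geodesic_segment_in[OF g that]] that unfolding rho_image_def by blast
      then have "mdist (cspace \<SS> V) (?\<sigma> W V z) (?\<sigma> W V z') \<le> \<bar>e2\<bar>"
        using z by (intro set_diam_leD[OF diam])
      then show ?thesis using E e2 by linarith
    qed
    show "\<exists>x\<in>mspace X. \<forall>V\<in>F. mdist (cspace \<SS> V) (?\<pi> V x) (?\<pi> V (u V)) \<le> E \<and>
            (\<forall>W. pnested \<SS> V W \<or> transverse \<SS> V W \<longrightarrow> mdist (cspace \<SS> W) (?\<pi> W x) (?\<rho> V W) \<le> E)"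
      if F: "F \<subseteq> index \<SS>" "\<And>V W. V \<in> F \<Longrightarrow> W \<in> F \<Longrightarrow> V \<noteq> W \<Longrightarrow> (V, W) \<in> orth \<SS>"
        and u: "\<And>V. V \<in> F \<Longrightarrow> u V \<in> mspace X" for F u
    proof -
      have "?\<pi> V (u V) \<in> proj_set \<SS> V (mspace X)" if "V \<in> F" for V
        using \<pi>[of V "u V"] u[OF that] that F(1) unfolding proj_set_def by blast
      then obtain x where x: "x \<in> mspace X" "\<And>V. V \<in> F \<Longrightarrow> pdist_set \<SS> V x {?\<pi> V (u V)} \<le> ennreal \<alpha>"
        "\<And>V W. V \<in> F \<Longrightarrow> pnested \<SS> V W \<or> transverse \<SS> W V \<Longrightarrow>
            pdist_set \<SS> W x (rho_set \<SS> V W) \<le> ennreal \<alpha>"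
        using realization[OF F, of "\<lambda>V. ?\<pi> V (u V)"] by blast
      have "mdist (cspace \<SS> V) (?\<pi> V x) (?\<pi> V (u V)) \<le> E" if V: "V \<in> F" for V
      proof -
        have VI: "V \<in> index \<SS>" using V F(1) by blast
        have "set_dist (cspace \<SS> V) (proj \<SS> V x) {?\<pi> V (u V)} \<le> ennreal \<alpha>"
          using x(2)[OF V] unfolding pdist_set_def .
        then obtain p where p: "p \<in> proj \<SS> V x" "mdist (cspace \<SS> V) p (?\<pi> V (u V)) \<le> \<bar>\<alpha>\<bar> + 1"
          using set_dist_leD by blast
        have "mdist (cspace \<SS> V) (?\<pi> V x) p \<le> \<bar>\<xi>\<bar>"
          using set_diam_leD[OF proj_diam[OF VI x(1)] \<pi>[OF VI x(1)] p(1)] .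
        moreover have "mdist (cspace \<SS> V) (?\<pi> V x) (?\<pi> V (u V))
            \<le> mdist (cspace \<SS> V) (?\<pi> V x) p + mdist (cspace \<SS> V) p (?\<pi> V (u V))"
          using p(1) proj_sub[OF VI x(1)] \<pi>_in[OF VI] x(1) u[OF V] by (intro mdist_triangle) auto
        ultimately show ?thesis using p(2) E nonneg by linarith
      qed
      moreover have "mdist (cspace \<SS> W) (?\<pi> W x) (?\<rho> V W) \<le> E"
        if "V \<in> F" "pnested \<SS> V W \<or> transverse \<SS> V W" for V W
        using \<pi>\<rho>[OF x(3)[OF that(1)] _ x(1) that(2)] that(2) tr_sym by blast
      ultimately show ?thesis using x(1) by blast
    qed
    show "\<exists>\<theta>. \<forall>x\<in>mspace X. \<forall>y\<in>mspace X.
        (\<forall>W\<in>index \<SS>. mdist (cspace \<SS> W) (?\<pi> W x) (?\<pi> W y) < \<kappa>) \<longrightarrow> mdist X x y \<le> \<theta>" for \<kappa>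
    proof -
      \<comment> \<open>The uniqueness axiom concerns nonnegative thresholds only, hence
        \<open>max \<kappa> 0\<close>.\<close>
      obtain \<theta> where \<theta>: "\<And>x y. x \<in> mspace X \<Longrightarrow> y \<in> mspace X \<Longrightarrow> mdist X x y \<ge> \<theta> \<Longrightarrow>
          \<exists>V\<in>index \<SS>. pdist \<SS> V x y \<ge> ennreal (max \<kappa> 0)"
        using uniqueness unfolding hhs_uniqueness_def by (meson max.cobounded2)
      have "mdist X x y \<le> \<theta>" if xy: "x \<in> mspace X" "y \<in> mspace X"
        and small: "\<And>W. W \<in> index \<SS> \<Longrightarrow> mdist (cspace \<SS> W) (?\<pi> W x) (?\<pi> W y) < \<kappa>" for x y
      proof (rule ccontr)
        assume "\<not> ?thesis"
        then obtain V where V: "V \<in> index \<SS>" "ennreal (max \<kappa> 0) \<le> pdist \<SS> V x y"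
          using \<theta>[OF xy] by force
        have "pdist \<SS> V x y \<le> ennreal (mdist (cspace \<SS> V) (?\<pi> V x) (?\<pi> V y))"
          unfolding pdist_def using \<pi> V(1) xy by (intro set_dist_leI) auto
        then have "ennreal (max \<kappa> 0) \<le> ennreal (mdist (cspace \<SS> V) (?\<pi> V x) (?\<pi> V y))"
          using V(2) order_trans by blast
        then show False using small[OF V(1)] by simp
      qed
      then show ?thesis by blast
    qed
    show "finite F \<and> card F \<le> n"
      if "F \<subseteq> index \<SS>" "\<And>V W. V \<in> F \<Longrightarrow> W \<in> F \<Longrightarrow> V \<noteq> W \<Longrightarrow> (V, W) \<in> orth \<SS>" for F
      using orthogonal_family_bounded[OF that] .
    show "transverse \<SS> V W \<longleftrightarrow> V \<in> index \<SS> \<and> W \<in> index \<SS> \<and> V \<noteq> W \<and> \<not> pnested \<SS> V W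
        \<and> \<not> pnested \<SS> W V \<and> (V, W) \<notin> orth \<SS>" for V W
      by (rule transverse_iff)
  qed (use E(1) pn_I orth_sym level_less level_le in \<open>auto simp: pnested_def\<close>)
  then show ?thesis using that E(2) by blast
qed

section \<open>The retraction\<close>

text \<open>Sample a quasigeodesic at integer times; its lower bound gives
  \<open>L \<le> q * (d + q)\<close>. The number of steps depends only on the upper bound
  \<open>d\<close>, so many pairs of points can be moved in the same number of steps.\<close>

lemma quasigeodesic_chain:
  assumes q: "quasigeodesic_space q X" and xy: "x \<in> mspace X" "y \<in> mspace X" and d: "mdist X x y \<le> d"
  obtains \<gamma> :: "nat \<Rightarrow> 'x" where "\<And>i. \<gamma> i \<in> mspace X" "\<gamma> 0 = x" "\<gamma> (nat \<lceil>q * (d + q)\<rceil>) = y"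
    "\<And>i. mdist X (\<gamma> i) (\<gamma> (Suc i)) \<le> 2 * q"
proof -
  have q1: "1 \<le> q" using q by (simp add: quasigeodesic_space_def)
  obtain g L where L: "0 \<le> L" "g \<in> {0..L} \<rightarrow> mspace X" "g 0 = x" "g L = y"
    and g: "\<And>s t. s \<in> {0..L} \<Longrightarrow> t \<in> {0..L} \<Longrightarrow>
      \<bar>s - t\<bar> / q - q \<le> mdist X (g s) (g t) \<and> mdist X (g s) (g t) \<le> q * \<bar>s - t\<bar> + q"
    using q xy unfolding quasigeodesic_space_def by meson
  have "L / q - q \<le> d" using g[of 0 L] L d by force
  then have "L \<le> q * (d + q)" using q1 by (simp add: field_simps)
  then have N: "L \<le> real (nat \<lceil>q * (d + q)\<rceil>)" using L(1) by linarith
  \<comment> \<open>Stopping at time \<open>L\<close> keeps the chain at \<open>y\<close> once it is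
    reached, which makes rounding up harmless.\<close>
  define \<gamma> where "\<gamma> i = g (min (real i) L)" for i
  show ?thesis
  proof
    fix i :: nat
    have 1: "min (real i) L \<in> {0..L}" "min (real (Suc i)) L \<in> {0..L}" using L(1) by auto
    show "\<gamma> i \<in> mspace X" unfolding \<gamma>_def using 1 L(2) by blast
    have "\<bar>min (real i) L - min (real (Suc i)) L\<bar> \<le> 1" by auto
    then have "q * \<bar>min (real i) L - min (real (Suc i)) L\<bar> \<le> q * 1"
      using q1 by (intro mult_left_mono) auto
    then show "mdist X (\<gamma> i) (\<gamma> (Suc i)) \<le> 2 * q" unfolding \<gamma>_def using g[OF 1] by linarith
  next
    show "\<gamma> 0 = x" "\<gamma> (nat \<lceil>q * (d + q)\<rceil>) = y" unfolding \<gamma>_def using L N by (auto simp: min_absorb2)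
  qed
qed

lemma mdist_chain_le:
  assumes "\<And>i. h i \<in> mspace X" "\<And>i. mdist X (h i) (h (Suc i)) \<le> r"
  shows "mdist X (h 0) (h n) \<le> real n * r"
proof (induction n)
  case 0
  show ?case using mdist_self[OF assms(1)] by simp
next
  case (Suc n)
  have "mdist X (h 0) (h (Suc n)) \<le> mdist X (h 0) (h n) + mdist X (h n) (h (Suc n))"
    using assms(1) by (intro mdist_triangle)
  then show ?case using Suc assms(2)[of n] by (simp add: algebra_simps)
qed

text \<open>\<open>r\<close> is the jump per step. The distance \<open>d + 1\<close> occurs because
  a Hausdorff distance need not be attained; the final summands 1 make the constant at least
  1.\<close>

lemma chain_length_bound:
  fixes q d r :: real
  assumes "1 \<le> q" "0 \<le> d" "0 \<le> r"
  shows "real (nat \<lceil>q * (d + 1 + q)\<rceil>) * r \<le> ((q * q + q + 1) * r + 1) * d + ((q * q + q + 1) * r + 1)"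
proof -
  have "0 \<le> q * (d + 1 + q)" using assms by simp
  then have "real (nat \<lceil>q * (d + 1 + q)\<rceil>) \<le> q * (d + 1 + q) + 1" by linarith
  also have "\<dots> \<le> (q * q + q + 1) * d + (q * q + q + 1)"
  proof -
    have "0 \<le> (q * q + 1) * d" using assms by simp
    then show ?thesis by (simp add: algebra_simps)
  qed
  finally have "real (nat \<lceil>q * (d + 1 + q)\<rceil>) * r \<le> ((q * q + q + 1) * d + (q * q + q + 1)) * r"
    using assms(3) by (rule mult_right_mono)
  then show ?thesis using assms(2) by (simp add: algebra_simps)
qed

text \<open>Two sets at finite Hausdorff distance are joined by a sequence of sets with bounded Hausdorff
  distance between neighbours: move all points simultaneously along quasigeodesics.\<close>

lemma interpolating_sets:
  assumes q: "quasigeodesic_space q X"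
    and A: "A \<subseteq> mspace X" "A \<noteq> {}" and A': "A' \<subseteq> mspace X"
    and fin: "Hausdorff_distance X A A' < \<infinity>"
  obtains S :: "nat \<Rightarrow> 'x set" where "S 0 = A"
    "S (nat \<lceil>q * (enn2real (Hausdorff_distance X A A') + 1 + q)\<rceil>) = A'"
    "\<And>i. S i \<subseteq> mspace X" "\<And>i. S i \<noteq> {}"
    "\<And>i a. a \<in> S i \<Longrightarrow> \<exists>a'\<in>S (Suc i). mdist X a a' \<le> 2 * q"
    "\<And>i a. a \<in> S (Suc i) \<Longrightarrow> \<exists>a'\<in>S i. mdist X a a' \<le> 2 * q"
proof -
  define d where "d = enn2real (Hausdorff_distance X A A')"
  \<comment> \<open>A correspondence whose projections are onto \<open>A\<close> and
    \<open>A'\<close>. Each pair gets its own chain of the common length \<open>?N\<close>, and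
    \<open>S i\<close> collects the positions at time \<open>i\<close>.\<close>
  define P where "P = {(a, a'). a \<in> A \<and> a' \<in> A' \<and> mdist X a a' \<le> d + 1}"
  have d: "Hausdorff_distance X A A' = ennreal d" "0 \<le> d" using fin by (simp_all add: d_def)
  have near: "\<exists>b\<in>C. mdist X a b \<le> d + 1" if "set_dist X {a} C \<le> Hausdorff_distance X A A'" for a C
    using that d set_dist_leD[of X "{a}" C d] by (metis abs_of_nonneg singletonD)
  have P1: "\<exists>a'. (a, a') \<in> P" if a: "a \<in> A" for a
  proof -
    have "set_dist X {a} A' \<le> Hausdorff_distance X A A'"
      unfolding Hausdorff_distance_def using a by (intro max.coboundedI1 SUP_upper)
    then show ?thesis using near a unfolding P_def by blast
  qed
  have P2: "\<exists>a. (a, a') \<in> P" if a': "a' \<in> A'" for a'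
  proof -
    have "set_dist X {a'} A \<le> Hausdorff_distance X A A'"
      unfolding Hausdorff_distance_def using a' by (intro max.coboundedI2 SUP_upper)
    then obtain a where "a \<in> A" "mdist X a' a \<le> d + 1" using near by blast
    then show ?thesis using a' mdist_commute[of X a a'] unfolding P_def by auto
  qed
  let ?N = "nat \<lceil>q * (d + 1 + q)\<rceil>"
  have "\<forall>p\<in>P. \<exists>\<gamma>::nat \<Rightarrow> 'x. (\<forall>i. \<gamma> i \<in> mspace X \<and> mdist X (\<gamma> i) (\<gamma> (Suc i)) \<le> 2 * q) \<and>
      \<gamma> 0 = fst p \<and> \<gamma> ?N = snd p"
  proof
    fix p assume "p \<in> P"
    then have "fst p \<in> mspace X" "snd p \<in> mspace X" "mdist X (fst p) (snd p) \<le> d + 1"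
      using A A' unfolding P_def by auto
    then show "\<exists>\<gamma>::nat \<Rightarrow> 'x. (\<forall>i. \<gamma> i \<in> mspace X \<and> mdist X (\<gamma> i) (\<gamma> (Suc i)) \<le> 2 * q) \<and>
        \<gamma> 0 = fst p \<and> \<gamma> ?N = snd p"
      by (rule quasigeodesic_chain[OF q]) blast
  qed
  then obtain \<gamma> :: "'x \<times> 'x \<Rightarrow> nat \<Rightarrow> 'x" where
    \<gamma>: "\<And>p i. p \<in> P \<Longrightarrow> \<gamma> p i \<in> mspace X" "\<And>p i. p \<in> P \<Longrightarrow> mdist X (\<gamma> p i) (\<gamma> p (Suc i)) \<le> 2 * q"
      "\<And>p. p \<in> P \<Longrightarrow> \<gamma> p 0 = fst p" "\<And>p. p \<in> P \<Longrightarrow> \<gamma> p ?N = snd p"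
    by metis
  define S where "S i = (\<lambda>p. \<gamma> p i) ` P" for i
  have "fst ` P = A" "snd ` P = A'" using P1 P2 unfolding P_def by force+
  then have ends: "S 0 = A" "S ?N = A'" unfolding S_def using \<gamma>(3,4) by (simp_all cong: image_cong)
  show ?thesis
  proof (rule that[of S])
    show "S (nat \<lceil>q * (enn2real (Hausdorff_distance X A A') + 1 + q)\<rceil>) = A'"
      using ends(2) unfolding d_def .
    fix i
    show "S i \<subseteq> mspace X" using \<gamma>(1) unfolding S_def by blast
    show "S i \<noteq> {}" using A(2) P1 unfolding S_def by blast
    fix a
    show "\<exists>a'\<in>S (Suc i). mdist X a a' \<le> 2 * q" if "a \<in> S i"
      using that \<gamma>(2) unfolding S_def by blast
    show "\<exists>a'\<in>S i. mdist X a a' \<le> 2 * q" if a: "a \<in> S (Suc i)"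
    proof -
      obtain p where p: "p \<in> P" "a = \<gamma> p (Suc i)" using a unfolding S_def by blast
      have "mdist X a (\<gamma> p i) \<le> 2 * q" using \<gamma>(2)[OF p(1), of i] p(2) by (simp add: mdist_commute)
      then show ?thesis using p(1) unfolding S_def by blast
    qed
  qed (rule ends(1))
qed

theorem proposition6p3:
  fixes X :: "'x metric" and \<SS> :: "('x, 'i, 'c) hhs_structure"
  assumes "hierarchically_hyperbolic_space X \<SS>"
  shows "\<exists>\<theta>\<^sub>0\<ge>0. \<forall>\<theta>\<ge>\<theta>\<^sub>0. \<exists>K\<ge>1. \<exists>C\<ge>1. \<exists>r :: 'x set \<Rightarrow> 'x \<Rightarrow> 'x.
    (\<forall>A\<subseteq>mspace X. A \<noteq> {} \<longrightarrow>
       r A \<in> mspace X \<rightarrow> H_theta X \<SS> \<theta> A \<and>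
       coarsely_Lipschitz_on K K X X (r A) \<and>
       (\<forall>x\<in>H_theta X \<SS> \<theta> A. r A x = x)) \<and>
    (\<forall>A\<subseteq>mspace X. \<forall>A'\<subseteq>mspace X. A \<noteq> {} \<and> A' \<noteq> {} \<and> Hausdorff_distance X A A' < \<infinity> \<longrightarrow>
       (\<forall>x\<in>mspace X. mdist X (r A x) (r A' x) \<le> C * enn2real (Hausdorff_distance X A A') + C))"
proof (cases "mspace X = {}")
  case True
  then show ?thesis by (intro exI[of _ 0] conjI allI impI exI[of _ "1::real"]) auto
next
  case ne: False
  obtain q where q: "quasigeodesic_space q X"
    using assms unfolding hierarchically_hyperbolic_space_def by blast
  have q1: "1 \<le> q" using q by (simp add: quasigeodesic_space_def)
  obtain \<delta> where hyp: "\<And>W. W \<in> index \<SS> \<Longrightarrow> hyperbolic_geodesic_space \<delta> (cspace \<SS> W)"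
    using assms unfolding hierarchically_hyperbolic_space_def by blast
  obtain \<xi> K \<kappa>\<^sub>0 where hhs: "hhs_projections X \<SS> \<xi> K" "hhs_nesting \<SS> \<xi>" "hhs_orthogonality \<SS>"
      "hhs_consistency X \<SS> \<xi> \<kappa>\<^sub>0" "hhs_finite_complexity \<SS>" "hhs_large_links X \<SS> \<xi> \<kappa>\<^sub>0"
      "hhs_bounded_geodesic_image \<SS>" "hhs_partial_realization X \<SS>" "hhs_uniqueness X \<SS>"
    using assms unfolding hierarchically_hyperbolic_space_def by (elim conjE exE)
  obtain n where n: "\<And>\<V>. \<V> \<subseteq> index \<SS> \<Longrightarrow> nest_chain \<SS> \<V> \<Longrightarrow> finite \<V> \<and> card \<V> \<le> n"
    using hhs(5) unfolding hhs_finite_complexity_def nest_chain_def by meson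
  interpret hhs_order \<SS> \<xi> n by standard (use hhs n in auto)
  obtain E where E: "\<bar>\<xi>\<bar> \<le> E" and coarse: "coarse_hhs X (index \<SS>) (cspace \<SS>) (pnested \<SS>)
      (\<lambda>V W. (V, W) \<in> orth \<SS>) (choose_proj \<SS>) (choose_rho \<SS>) (choose_rho_map \<SS>) E (hhs_level \<SS>) n
      (transverse \<SS>)"
    using coarse_hhs_choice[OF ne hyp hhs(1,4,6-9)] .
  interpret c: coarse_hhs X "index \<SS>" "cspace \<SS>" "pnested \<SS>" "\<lambda>V W. (V, W) \<in> orth \<SS>"
    "choose_proj \<SS>" "choose_rho \<SS>" "choose_rho_map \<SS>" E "hhs_level \<SS>" n "transverse \<SS>"
    by (rule coarse)
  let ?\<pi> = "choose_proj \<SS>"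
  have proj: "?\<pi> W x \<in> proj \<SS> W x" "proj \<SS> W x \<subseteq> mspace (cspace \<SS> W)"
    "\<And>p p'. p \<in> proj \<SS> W x \<Longrightarrow> p' \<in> proj \<SS> W x \<Longrightarrow> mdist (cspace \<SS> W) p p' \<le> E"
    if "W \<in> index \<SS>" "x \<in> mspace X" for W x
  proof -
    have *: "proj \<SS> W x \<subseteq> mspace (cspace \<SS> W)" "proj \<SS> W x \<noteq> {}"
      "set_diam (cspace \<SS> W) (proj \<SS> W x) \<le> ennreal \<xi>"
      using hhs(1) that by (simp_all add: hhs_projections_def)
    show "proj \<SS> W x \<subseteq> mspace (cspace \<SS> W)" by (rule *)
    show "?\<pi> W x \<in> proj \<SS> W x" using *(2) unfolding choose_proj_def by (simp add: some_in_eq)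
    show "mdist (cspace \<SS> W) p p' \<le> E" if "p \<in> proj \<SS> W x" "p' \<in> proj \<SS> W x" for p p'
      using set_diam_leD[OF *(3) that] E by linarith
  qed
  have proj_set_sub: "proj_set \<SS> W A \<subseteq> mspace (cspace \<SS> W)" "?\<pi> W ` A \<subseteq> proj_set \<SS> W A"
    if "W \<in> index \<SS>" "A \<subseteq> mspace X" for W A
    using proj(1,2)[OF that(1)] that(2) unfolding proj_set_def by blast+
  \<comment> \<open>This determines the threshold for \<open>\<theta>\<close>: the realized points
    must lie in \<open>H_theta\<close>.\<close>
  have gate_in_H: "y \<in> H_theta X \<SS> \<theta> A"
    if \<theta>: "c.gate_constant \<le> \<theta>" and A: "A \<subseteq> mspace X" and gate: "c.is_gate c.gate_constant A x y"
    for \<theta> A x y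
  proof -
    have y: "y \<in> mspace X" using gate unfolding c.is_gate_def by blast
    have "pdist_set \<SS> W y (geodesic_hull (cspace \<SS> W) (proj_set \<SS> W A)) \<le> ennreal \<theta>"
      if W: "W \<in> index \<SS>" for W
    proof -
      obtain b where b: "b \<in> c.coord_hull A W" "mdist (cspace \<SS> W) (?\<pi> W y) b \<le> c.gate_constant"
        using gate W unfolding c.is_gate_def near_projection_def by blast
      have "b \<in> geodesic_hull (cspace \<SS> W) (proj_set \<SS> W A)"
        using b(1) geodesic_hull_mono[OF proj_set_sub(2)[OF W A]] unfolding c.coord_hull_def by blast
      then show ?thesis
        unfolding pdist_set_def using proj(1)[OF W y] b(2) \<theta> by (intro set_dist_leI) auto
    qed
    then show ?thesis using y unfolding H_theta_def by blast
  qed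
  \<comment> \<open>The tolerance adds \<open>E\<close> (chosen point to \<open>p\<close>),
    \<open>\<theta> + 1\<close> (to the hull of the full sets), \<open>3 * E\<close> (to the hull of
    the chosen points) and 1 (near projection).\<close>
  have H_gate: "c.is_gate (\<theta> + 4 * E + 2) A x x"
    if \<theta>: "0 \<le> \<theta>" and A: "A \<subseteq> mspace X" "A \<noteq> {}" and x: "x \<in> H_theta X \<SS> \<theta> A" for \<theta> A x
  proof -
    have xX: "x \<in> mspace X" using x unfolding H_theta_def by blast
    have "\<exists>b. near_projection (cspace \<SS> W) (c.coord_hull A W) (?\<pi> W x) b \<and>
        mdist (cspace \<SS> W) (?\<pi> W x) b \<le> \<theta> + 4 * E + 2" if W: "W \<in> index \<SS>" for W
    proof -
      interpret W: slim_space "cspace \<SS> W" E by (rule c.slim_space[OF W])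
      have "set_dist (cspace \<SS> W) (proj \<SS> W x) (geodesic_hull (cspace \<SS> W) (proj_set \<SS> W A)) \<le> ennreal \<theta>"
        using x W unfolding H_theta_def pdist_set_def by blast
      then obtain p v where p: "p \<in> proj \<SS> W x" and v: "v \<in> geodesic_hull (cspace \<SS> W) (proj_set \<SS> W A)"
        and pv: "mdist (cspace \<SS> W) p v \<le> \<bar>\<theta>\<bar> + 1"
        by (rule set_dist_leD)
      have close: "\<exists>p'\<in>?\<pi> W ` A. mdist (cspace \<SS> W) p p' \<le> E" if "p \<in> proj_set \<SS> W A" for p
        using that proj(1,3)[OF W] A(1) unfolding proj_set_def by blast
      obtain w where w: "w \<in> c.coord_hull A W" "mdist (cspace \<SS> W) v w \<le> E + 2 * E"
        unfolding c.coord_hull_def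
        by (rule W.hull_close[OF proj_set_sub(1)[OF W A(1)]
            subset_trans[OF proj_set_sub(2)[OF W A(1)] proj_set_sub(1)[OF W A(1)]] close v])
      have "c.coord_hull A W \<noteq> {}" using w(1) by blast
      then obtain b where b: "near_projection (cspace \<SS> W) (c.coord_hull A W) (?\<pi> W x) b"
        by (rule near_projection_exists)
      have in_m: "p \<in> mspace (cspace \<SS> W)" "v \<in> mspace (cspace \<SS> W)" "w \<in> mspace (cspace \<SS> W)"
        using p proj(2)[OF W xX] geodesic_hull_in[OF v] c.coord_hull_in[OF w(1)] by auto
      have "mdist (cspace \<SS> W) (?\<pi> W x) w \<le> mdist (cspace \<SS> W) (?\<pi> W x) p + mdist (cspace \<SS> W) p w"
        "mdist (cspace \<SS> W) p w \<le> mdist (cspace \<SS> W) p v + mdist (cspace \<SS> W) v w"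
        using in_m W xX by (simp_all add: c.triangle)
      moreover have "mdist (cspace \<SS> W) (?\<pi> W x) p \<le> E" using proj[OF W xX] p by blast
      moreover have "mdist (cspace \<SS> W) (?\<pi> W x) b \<le> mdist (cspace \<SS> W) (?\<pi> W x) w + 1"
        using b w(1) unfolding near_projection_def by blast
      ultimately have "mdist (cspace \<SS> W) (?\<pi> W x) b \<le> \<theta> + 4 * E + 2" using pv w(2) \<theta> by linarith
      then show ?thesis using b by blast
    qed
    then show ?thesis using xX unfolding c.is_gate_def by blast
  qed
  have gate_mono: "c.is_gate t' A x y" if "c.is_gate t A x y" "t \<le> t'" for t t' A x y
    using that unfolding c.is_gate_def by (meson order_trans)
  show ?thesis
  proof (rule exI[of _ "max 0 c.gate_constant"], intro conjI allI impI)
    fix \<theta> :: real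
    assume \<theta>: "max 0 c.gate_constant \<le> \<theta>"
    \<comment> \<open>A common tolerance for realized gates and for the fixed points, so that
      \<open>gates_close\<close> also compares one kind with the other.\<close>
    define t where "t = max c.gate_constant (\<theta> + 4 * E + 2)"
    obtain \<Theta> where \<Theta>0: "0 \<le> \<Theta>" and \<Theta>: "\<And>A A' x x' y y'. \<lbrakk>A \<subseteq> mspace X; A' \<subseteq> mspace X;
        x \<in> mspace X; x' \<in> mspace X; mdist X x x' \<le> 2 * q;
        \<And>a. a \<in> A \<Longrightarrow> \<exists>a'\<in>A'. mdist X a a' \<le> 2 * q; \<And>a'. a' \<in> A' \<Longrightarrow> \<exists>a\<in>A. mdist X a' a \<le> 2 * q;
        c.is_gate t A x y; c.is_gate t A' x' y'\<rbrakk> \<Longrightarrow> mdist X y y' \<le> \<Theta>"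
      using c.gates_close[of "2 * q" t] by blast
    define r where "r A x =
      (if x \<in> H_theta X \<SS> \<theta> A then x else SOME y. c.is_gate c.gate_constant A x y)" for A x
    \<comment> \<open>At most \<open>(q * q + q + 1) * (d + 1)\<close> steps are made, each moving
      the value by at most \<open>\<Theta>\<close>.\<close>
    define C where "C = (q * q + q + 1) * \<Theta> + 1"
    have C: "1 \<le> C" using q1 \<Theta>0 by (simp add: C_def)
    have r: "c.is_gate t A x (r A x)" "r A x \<in> H_theta X \<SS> \<theta> A" "r A x \<in> mspace X"
      if A: "A \<subseteq> mspace X" "A \<noteq> {}" and x: "x \<in> mspace X" for A x
    proof -
      have "c.is_gate t A x (r A x) \<and> r A x \<in> H_theta X \<SS> \<theta> A"
      proof (cases "x \<in> H_theta X \<SS> \<theta> A")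
        case True
        then show ?thesis
          using gate_mono[OF H_gate[OF _ A True], of t] \<theta> by (simp add: r_def t_def)
      next
        case False
        have "c.is_gate c.gate_constant A x (SOME y. c.is_gate c.gate_constant A x y)"
          using c.gate_exists[OF A x] by (metis someI)
        then show ?thesis
          using False gate_mono[of c.gate_constant A x _ t] gate_in_H[OF _ A(1)] \<theta>
          by (simp add: r_def t_def)
      qed
      then show "c.is_gate t A x (r A x)" "r A x \<in> H_theta X \<SS> \<theta> A" "r A x \<in> mspace X"
        by (auto simp: H_theta_def)
    qed
    have Lip: "mdist X (r A x) (r A y) \<le> C * mdist X x y + C"
      if A: "A \<subseteq> mspace X" "A \<noteq> {}" and xy: "x \<in> mspace X" "y \<in> mspace X" for A x y
    proof -
      \<comment> \<open>The distance is enlarged by 1 only to share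
        \<open>chain_length_bound\<close> with the estimate in the set \<open>A\<close>.\<close>
      obtain \<gamma> :: "nat \<Rightarrow> 'x" where \<gamma>: "\<And>i. \<gamma> i \<in> mspace X" "\<gamma> 0 = x"
        "\<gamma> (nat \<lceil>q * (mdist X x y + 1 + q)\<rceil>) = y" "\<And>i. mdist X (\<gamma> i) (\<gamma> (Suc i)) \<le> 2 * q"
        using quasigeodesic_chain[OF q xy, of "mdist X x y + 1"] by auto
      have AA: "\<exists>a'\<in>A. mdist X a a' \<le> 2 * q" if "a \<in> A" for a
        using that mdist_self[OF subsetD[OF A(1) that]] q1 by (intro bexI[of _ a]) linarith+
      have "mdist X (r A (\<gamma> i)) (r A (\<gamma> (Suc i))) \<le> \<Theta>" for i
        by (rule \<Theta>[OF A(1) A(1) \<gamma>(1) \<gamma>(1) \<gamma>(4) AA AA r(1)[OF A \<gamma>(1)] r(1)[OF A \<gamma>(1)]])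
      then have "mdist X (r A (\<gamma> 0)) (r A (\<gamma> (nat \<lceil>q * (mdist X x y + 1 + q)\<rceil>)))
          \<le> real (nat \<lceil>q * (mdist X x y + 1 + q)\<rceil>) * \<Theta>"
        using r(3)[OF A \<gamma>(1)] by (intro mdist_chain_le[of "\<lambda>i. r A (\<gamma> i)"])
      then show ?thesis
        using chain_length_bound[OF q1 mdist_nonneg \<Theta>0, of X x y] \<gamma>(2,3) by (simp add: C_def)
    qed
    have Haus: "mdist X (r A x) (r A' x)
        \<le> C * enn2real (Hausdorff_distance X A A') + C"
      if A: "A \<subseteq> mspace X" "A \<noteq> {}" and A': "A' \<subseteq> mspace X"
        and fin: "Hausdorff_distance X A A' < \<infinity>" and x: "x \<in> mspace X" for A A' x
    proof -
      let ?N = "nat \<lceil>q * (enn2real (Hausdorff_distance X A A') + 1 + q)\<rceil>"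
      obtain S :: "nat \<Rightarrow> 'x set" where S: "S 0 = A" "S ?N = A'" "\<And>i. S i \<subseteq> mspace X" "\<And>i. S i \<noteq> {}"
        "\<And>i a. a \<in> S i \<Longrightarrow> \<exists>a'\<in>S (Suc i). mdist X a a' \<le> 2 * q"
        "\<And>i a. a \<in> S (Suc i) \<Longrightarrow> \<exists>a'\<in>S i. mdist X a a' \<le> 2 * q"
        using interpolating_sets[OF q A A' fin] by blast
      have xx: "mdist X x x \<le> 2 * q" using mdist_self[OF x] q1 by linarith
      have "mdist X (r (S i) x) (r (S (Suc i)) x) \<le> \<Theta>" for i
        by (rule \<Theta>[OF S(3)[of i] S(3)[of "Suc i"] x x xx S(5)[of _ i] S(6)[of _ i]
              r(1)[OF S(3,4) x] r(1)[OF S(3,4) x]])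
      then have "mdist X (r (S 0) x) (r (S ?N) x) \<le> real ?N * \<Theta>"
        using r(3)[OF S(3,4) x] by (intro mdist_chain_le[of "\<lambda>i. r (S i) x"])
      then show ?thesis
        using chain_length_bound[OF q1 enn2real_nonneg \<Theta>0, of "Hausdorff_distance X A A'"] S(1,2)
        by (simp add: C_def)
    qed
    have retraction: "r A \<in> mspace X \<rightarrow> H_theta X \<SS> \<theta> A \<and> coarsely_Lipschitz_on C C X X (r A) \<and>
        (\<forall>x\<in>H_theta X \<SS> \<theta> A. r A x = x)" if A: "A \<subseteq> mspace X" "A \<noteq> {}" for A
    proof (intro conjI)
      show "r A \<in> mspace X \<rightarrow> H_theta X \<SS> \<theta> A" using r(2)[OF A] by (rule Pi_I)
      show "coarsely_Lipschitz_on C C X X (r A)"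
        unfolding coarsely_Lipschitz_on_def using Lip[OF A] by blast
      show "\<forall>x\<in>H_theta X \<SS> \<theta> A. r A x = x" by (simp add: r_def)
    qed
    show "\<exists>K\<ge>1. \<exists>C\<ge>1. \<exists>r :: 'x set \<Rightarrow> 'x \<Rightarrow> 'x.
      (\<forall>A\<subseteq>mspace X. A \<noteq> {} \<longrightarrow>
         r A \<in> mspace X \<rightarrow> H_theta X \<SS> \<theta> A \<and>
         coarsely_Lipschitz_on K K X X (r A) \<and>
         (\<forall>x\<in>H_theta X \<SS> \<theta> A. r A x = x)) \<and>
      (\<forall>A\<subseteq>mspace X. \<forall>A'\<subseteq>mspace X. A \<noteq> {} \<and> A' \<noteq> {} \<and> Hausdorff_distance X A A' < \<infinity> \<longrightarrow>
         (\<forall>x\<in>mspace X. mdist X (r A x) (r A' x) \<le> C * enn2real (Hausdorff_distance X A A') + C))"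
    proof (rule exI[of _ C], rule conjI[OF C], rule exI[of _ C], rule conjI[OF C], rule exI[of _ r],
        intro conjI[OF allI[OF impI[OF impI]]] allI impI ballI)
      fix A assume "A \<subseteq> mspace X" "A \<noteq> {}"
      then show "r A \<in> mspace X \<rightarrow> H_theta X \<SS> \<theta> A \<and> coarsely_Lipschitz_on C C X X (r A) \<and>
        (\<forall>x\<in>H_theta X \<SS> \<theta> A. r A x = x)" by (rule retraction)
    next
      fix A A' x
      assume "A \<subseteq> mspace X" "A' \<subseteq> mspace X"
        "A \<noteq> {} \<and> A' \<noteq> {} \<and> Hausdorff_distance X A A' < \<infinity>" "x \<in> mspace X"
      then show "mdist X (r A x) (r A' x) \<le> C * enn2real (Hausdorff_distance X A A') + C"
        by (elim conjE) (rule Haus)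
    qed
  qed simp
qed

end
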